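(* Let $M$ be a rank $k$ matroid on a ground set $E$ of size $n$ with $0<k<n$, let $S=\mathbb{L}[x_e : e\in E]$ be a polynomial ring over a field $\mathbb{L}$, let $\Delta=\Delta(M)$ be the independence complex of $M$, and let $\{d_i(M)\}_{i=1}^{n-k}$ be the generalized Hamming weights of $M$. Then: (a) For $i\in[n-k]$, $d_i(M)=\alpha(I_{\Delta^{(i)}})\ge\alpha(I_\Delta^{(i)})$. (b) For $i\in[n-k]$, $\alpha(I_\Delta^{(i)})=d_i(M)$ if and only if $d_i(M)$ is a subadditive term of the sequence $\{d_i(M)\}_{i=1}^{n-k}$. (c) $\displaystyle\widehat{\alpha}(I_\Delta)=\min_{i\in[n-k]}\left\{\frac{d_i(M)}{i}\right\}=\min\left\{\frac{n-f_j^{\max}(M^* )}{n-k-j} : 0\le j\le n-k-1\right\}$. (d) For every $s\ge1$, $\displaystyle\alpha(I_\Delta^{(s)})=\min\Big\{\sum_{i=1}^{n-k}b_id_i(M) : b_i\in\mathbb{Z}_{\ge0}\text{ for } i\in[n-k],\ \sum_{i=1}^{n-k}ib_i=s\Big\}$. Moreover, the minimum is unchanged if one restricts to tuples with $b_i>0$ only when $d_i(M)$ is a strictly subadditive term of $\{d_i(M)\}_{i=1}^{n-k}$. (e) Assume $M$ has no loops and no coloops. The following are equivalent: - $\{d_i(M)\}_{i=1}^{n-k}$ is a subadditive and cosubadditive sequence. - For any $s=(n-k)q+r$ with $r\in[n-k]$ and $q\in\mathbb{Z}_{\ge0}$, $\alpha(I_\Delta^{(s)})=qd_{n-k}(M)+d_r(M)$.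 - For any $s=kq+r$ with $r\in[k]$ and $q\in\mathbb{Z}_{\ge0}$, $\alpha(I_{\Delta(M^* )}^{(s)})=qd_k(M^* )+d_r(M^* )$. Moreover, in this case, \[ \widehat{\alpha}(I_\Delta)=\frac{d_{n-k}(M)}{n-k}=\frac{n}{n-k},\quad \widehat{\alpha}(I_{\Delta(M^* )})=\frac{d_k(M^* )}{k}=\frac{n}{k},\quad\text{and}\quad \frac{1}{\widehat{\alpha}(I_\Delta)}+\frac{1}{\widehat{\alpha}(I_{\Delta(M^* )})}=1. \]
   Context: $[m]=\{1,\dots,m\}$. $M^*$ is the dual matroid. For a matroid $N$ of rank $\rho$ on a set $E$ of size $n$ and $r\in[n-\rho]$, the $r$-th generalized Hamming weight is $d_r(N)=\min\{|U|: U\subseteq E,\ |U|-\mathrm{rk}_N(U)=r\}$; and $f_j^{\max}(N)=\max\{|F|: F\subseteq E,\ \mathrm{rk}_N(F)=j\}$. The Stanley-Reisner ideal of the independence complex $\Delta(N)$ is $I_{\Delta(N)}=\langle x^C: C\text{ a circuit of }N\rangle=\bigcap_{B\in\mathcal{B}(N^* )}P_B$, where $x^U=\prod_{u\in U}x_u$, $P_B=\langle x_e: e\in B\rangle$ and $\mathcal{B}(N^* )$ is the set of bases of $N^*$; its symbolic powers are $I_{\Delta(N)}^{(s)}=\bigcap_{B\in\mathcal{B}(N^* )}P_B^s$. For $r\in[n-k]$, $M^{(r)}$ is the matroid on $E$ whose independent sets are the subsets $A$ with $|A|-\mathrm{rk}_M(A)\le r-1$ (the elongation of $M$ by rank $r-1$),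 and $I_{\Delta^{(r)}}$ is the Stanley-Reisner ideal in $S$ of the independence complex $\Delta^{(r)}=\Delta(M^{(r)})$. For a homogeneous ideal $I\ne0$, $\alpha(I)$ is the smallest degree of a nonzero homogeneous element of $I$ and $\widehat{\alpha}(I)=\lim_{s\to\infty}\alpha(I^{(s)})/s$ is the Waldschmidt constant. For a sequence $\{e_i\}_{i=1}^m$ of positive integers and $s\in[m]$, $e_s$ is a subadditive term if $e_s\le\sum_{i=1}^\ell e_{a_i}$ for all $\ell\ge1$ and all (not necessarily distinct) $a_1,\dots,a_\ell\in[m]$ with $\sum a_i=s$; it is a strictly subadditive term if $e_s<\sum_{i=1}^\ell e_{a_i}$ for all $\ell\ge2$ and all such $a_1,\dots,a_\ell$ with $\sum a_i=s$ ($e_1$ is always both). The sequence is subadditive if all its terms are subadditive. The sequence $\{d_i(M)\}_{i=1}^{n-k}$ is strictly increasing with values in $[n]$; its Wei dual is the sequence whose $i$-th term ($i\in[k]$) is the $i$-th element, in increasing order, of $[n]\setminus\{n+1-d_j(M): j\in[n-k]\}$ (and equals $\{d_i(M^* )\}_{i=1}^k$). A sequence is cosubadditive if its Wei dual is subadditive. *)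

theory Defs
  imports Complex_Main "HOL-Library.Poly_Mapping" "HOL-Algebra.Ideal_Product"
begin

section \<open>Matroids\<close>

record 'e matroid_data =
  ground :: "'e set"
  indep :: "'e set \<Rightarrow> bool"

locale matroid =
  fixes M :: "'e matroid_data"
  assumes finite_ground: "finite (ground M)"
    and indep_ground: "indep M A \<Longrightarrow> A \<subseteq> ground M"
    and indep_empty: "indep M {}"
    and indep_subset: "indep M A \<Longrightarrow> B \<subseteq> A \<Longrightarrow> indep M B"
    and indep_augment: "indep M A \<Longrightarrow> indep M B \<Longrightarrow> card A < card B \<Longrightarrow>
      \<exists>x\<in>B - A. indep M (insert x A)"

definition rk :: "'e matroid_data \<Rightarrow> 'e set \<Rightarrow> nat" where
  "rk M U = Max {card A | A. A \<subseteq> U \<and> indep M A}"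

definition bases :: "'e matroid_data \<Rightarrow> 'e set set" where
  "bases M = {B. indep M B \<and> (\<forall>A. indep M A \<and> B \<subseteq> A \<longrightarrow> A = B)}"

definition circuits :: "'e matroid_data \<Rightarrow> 'e set set" where
  "circuits M = {C. C \<subseteq> ground M \<and> \<not> indep M C \<and> (\<forall>A. A \<subset> C \<longrightarrow> indep M A)}"

definition loop :: "'e matroid_data \<Rightarrow> 'e \<Rightarrow> bool" where
  "loop M e \<longleftrightarrow> e \<in> ground M \<and> \<not> indep M {e}"

definition coloop :: "'e matroid_data \<Rightarrow> 'e \<Rightarrow> bool" where
  "coloop M e \<longleftrightarrow> e \<in> ground M \<and> (\<forall>B\<in>bases M. e \<in> B)"

definition dual :: "'e matroid_data \<Rightarrow> 'e matroid_data" where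
  "dual M = \<lparr>ground = ground M,
             indep = (\<lambda>A. \<exists>B\<in>bases M. A \<subseteq> ground M - B)\<rparr>"

text \<open>The elongation of rank \<open>rk M (ground M) + r - 1\<close>, for \<open>r \<ge> 1\<close>. Since
  \<open>rk M A \<le> card A\<close>, the subtraction \<open>card A - rk M A\<close> does not truncate.\<close>

definition elongation :: "'e matroid_data \<Rightarrow> nat \<Rightarrow> 'e matroid_data" where
  "elongation M r = \<lparr>ground = ground M,
                     indep = (\<lambda>A. A \<subseteq> ground M \<and> card A - rk M A \<le> r - 1)\<rparr>"

text \<open>Generalized Hamming weights \<open>d\<^sub>r(M)\<close>.\<close>

definition ghw :: "'e matroid_data \<Rightarrow> nat \<Rightarrow> nat" where
  "ghw M r = Min {card U | U. U \<subseteq> ground M \<and> card U - rk M U = r}"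

definition fmax :: "'e matroid_data \<Rightarrow> nat \<Rightarrow> nat" where
  "fmax M j = Max {card F | F. F \<subseteq> ground M \<and> rk M F = j}"


section \<open>Polynomials and ideals\<close>

text \<open>A monomial is its exponent vector, a polynomial a finitely supported family of coefficients
  indexed by monomials; multiplication on this type is convolution. \<open>mpoly_ring E\<close> is the
  subring of the polynomials involving only variables from \<open>E\<close>.\<close>

type_synonym ('e, 'l) mpoly = "('e \<Rightarrow>\<^sub>0 nat) \<Rightarrow>\<^sub>0 'l"

definition mpoly_ring :: "'e set \<Rightarrow> ('e, 'l::field) mpoly ring" where
  "mpoly_ring E = \<lparr>carrier = {p. \<forall>m\<in>Poly_Mapping.keys p. Poly_Mapping.keys m \<subseteq> E},
                   mult = (*), one = 1, zero = 0, add = (+)\<rparr>"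

lemma cring_mpoly_ring: "cring (mpoly_ring E :: ('e, 'l::field) mpoly ring)"
proof (rule cringI)
  let ?S = "mpoly_ring E :: ('e, 'l) mpoly ring"
  show "abelian_group ?S"
  proof (rule abelian_groupI)
    fix p q assume "p \<in> carrier ?S" "q \<in> carrier ?S"
    then show "p \<oplus>\<^bsub>?S\<^esub> q \<in> carrier ?S"
      using Poly_Mapping.keys_add[of p q] by (auto simp: mpoly_ring_def)
  next
    fix p assume "p \<in> carrier ?S"
    then show "\<exists>q\<in>carrier ?S. q \<oplus>\<^bsub>?S\<^esub> p = \<zero>\<^bsub>?S\<^esub>"
      by (intro bexI[of _ "- p"]) (auto simp: mpoly_ring_def)
  qed (auto simp: mpoly_ring_def add_ac)
  show "comm_monoid ?S"
  proof (rule comm_monoidI)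
    fix p q assume pq: "p \<in> carrier ?S" "q \<in> carrier ?S"
    have "Poly_Mapping.keys m \<subseteq> E" if m: "m \<in> Poly_Mapping.keys (p * q)" for m
    proof -
      obtain a b where "m = a + b" "a \<in> Poly_Mapping.keys p" "b \<in> Poly_Mapping.keys q"
        using m keys_mult[of p q] by blast
      then show ?thesis
        using pq Poly_Mapping.keys_add[of a b] by (fastforce simp: mpoly_ring_def)
    qed
    then show "p \<otimes>\<^bsub>?S\<^esub> q \<in> carrier ?S"
      by (auto simp: mpoly_ring_def)
  qed (auto simp: mpoly_ring_def mult_ac)
qed (auto simp: mpoly_ring_def algebra_simps)

definition mvar :: "'e \<Rightarrow> ('e, 'l::field) mpoly" where
  "mvar e = Poly_Mapping.single (Poly_Mapping.single e 1) 1"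

definition monomial_deg :: "('e \<Rightarrow>\<^sub>0 nat) \<Rightarrow> nat" where
  "monomial_deg m = (\<Sum>e\<in>Poly_Mapping.keys m. Poly_Mapping.lookup m e)"

definition homogeneous :: "nat \<Rightarrow> ('e, 'l::field) mpoly \<Rightarrow> bool" where
  "homogeneous t p \<longleftrightarrow> (\<forall>m\<in>Poly_Mapping.keys p. monomial_deg m = t)"

definition alpha :: "('e, 'l::field) mpoly set \<Rightarrow> nat" where
  "alpha I = (LEAST t. \<exists>p\<in>I. p \<noteq> 0 \<and> homogeneous t p)"

text \<open>The Stanley--Reisner ideal of the independence complex.\<close>

definition SR_ideal ::
    "('e, 'l::field) mpoly ring \<Rightarrow> 'e matroid_data \<Rightarrow> ('e, 'l) mpoly set" where
  "SR_ideal S M = genideal S {\<Prod>e\<in>C. mvar e | C. C \<in> circuits M}"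

text \<open>The symbolic power \<open>I_\<Delta>(M)^(s)\<close>, given by the prime decomposition of \<open>SR_ideal S M\<close>
  into the ideals generated by the variables of the bases of the dual. The power of an ideal is
  taken in the monoid of ideals of \<open>S\<close> under \<^const>\<open>ideal_prod\<close>.\<close>

definition symbolic_power ::
    "('e, 'l::field) mpoly ring \<Rightarrow> 'e matroid_data \<Rightarrow> nat \<Rightarrow> ('e, 'l) mpoly set" where
  "symbolic_power S M s =
    (\<Inter>B\<in>bases (dual M). genideal S (mvar ` B) [^]\<^bsub>ideals_set S\<^esub> s)"

text \<open>The Waldschmidt constant is the limit of \<open>waldschmidt_seq\<close>; the value of \<^const>\<open>lim\<close> is
  meaningful only if that sequence is convergent.\<close>

definition waldschmidt_seq ::
    "('e, 'l::field) mpoly ring \<Rightarrow> 'e matroid_data \<Rightarrow> nat \<Rightarrow> real" where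
  "waldschmidt_seq S M s = real (alpha (symbolic_power S M s)) / real s"

definition waldschmidt :: "('e, 'l::field) mpoly ring \<Rightarrow> 'e matroid_data \<Rightarrow> real" where
  "waldschmidt S M = lim (waldschmidt_seq S M)"


section \<open>Subadditivity\<close>

text \<open>A sequence \<open>e\<^sub>1, \<dots>, e\<^sub>m\<close> is given by its length \<open>m\<close> and a function \<open>e\<close>, of which only the
  values on \<open>{1..m}\<close> are used.\<close>

definition subadditive_term :: "nat \<Rightarrow> (nat \<Rightarrow> nat) \<Rightarrow> nat \<Rightarrow> bool" where
  "subadditive_term m e s \<longleftrightarrow>
    (\<forall>as. length as \<ge> 1 \<and> set as \<subseteq> {1..m} \<and> sum_list as = s \<longrightarrow> e s \<le> (\<Sum>a\<leftarrow>as. e a))"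

definition strictly_subadditive_term :: "nat \<Rightarrow> (nat \<Rightarrow> nat) \<Rightarrow> nat \<Rightarrow> bool" where
  "strictly_subadditive_term m e s \<longleftrightarrow>
    (\<forall>as. length as \<ge> 2 \<and> set as \<subseteq> {1..m} \<and> sum_list as = s \<longrightarrow> e s < (\<Sum>a\<leftarrow>as. e a))"

definition subadditive :: "nat \<Rightarrow> (nat \<Rightarrow> nat) \<Rightarrow> bool" where
  "subadditive m e \<longleftrightarrow> (\<forall>s\<in>{1..m}. subadditive_term m e s)"

text \<open>The Wei dual of a strictly increasing sequence of length \<open>m\<close> with values in \<open>{1..n}\<close> is a
  sequence of length \<open>n - m\<close>. Lists are indexed from 0, hence the shift.\<close>

definition wei_dual :: "nat \<Rightarrow> nat \<Rightarrow> (nat \<Rightarrow> nat) \<Rightarrow> nat \<Rightarrow> nat" where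
  "wei_dual n m e i = sorted_list_of_set ({1..n} - {n + 1 - e j | j. j \<in> {1..m}}) ! (i - 1)"

definition cosubadditive :: "nat \<Rightarrow> nat \<Rightarrow> (nat \<Rightarrow> nat) \<Rightarrow> bool" where
  "cosubadditive n m e \<longleftrightarrow> subadditive (n - m) (wei_dual n m e)"

end

theory Submission
  imports Defs
begin

text \<open>
  A monomial lies in \<open>P\<^sub>B\<^sup>s\<close> iff its exponent vector has weight at least \<open>s\<close> on \<open>B\<close>. Decompose an
  exponent vector into the chain of its level sets. By the greedy property some basis of the dual
  meets every member of the chain in exactly its nullity, so the least weight over all bases is the
  sum of the nullities of the level sets. Hence the initial degree of the \<open>s\<close>-th symbolic power is
  the least sum of Hamming weights \<open>d\<^sub>a\<close> over all decompositions of \<open>s\<close> into parts \<open>a\<close>;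
  (b), (c) and (d) are combinatorial consequences.

  For (e), extend \<open>d\<close> by \<open>d\<^sub>i\<^sub>+\<^sub>m = d\<^sub>i + n\<close>, where \<open>m = n - k\<close>. The initial degrees are given
  by this extension iff it is subadditive, which splits into subadditivity within one period and across a period
  boundary. Let \<open>N x\<close> be the number of weights at most \<open>x\<close>, i.e. the largest nullity of an
  \<open>x\<close>-element set. Subadditivity of \<open>d\<close> is superadditivity of \<open>N\<close>, and matroid duality gives
  \<open>N\<^sup>* x + m = x + N (n - x)\<close>, which both determines the Wei dual and exchanges the two conditions.
\<close>

section \<open>Rank and nullity\<close>

definition nullity :: "'e matroid_data \<Rightarrow> 'e set \<Rightarrow> nat" where
  "nullity M U = card U - rk M U"

context matroid
begin

lemma finite_subset_ground: "U \<subseteq> ground M \<Longrightarrow> finite U"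
  using finite_ground finite_subset by blast

lemma finite_indep: "indep M A \<Longrightarrow> finite A"
  using indep_ground finite_subset_ground by blast

lemma finite_indep_cards: "finite {card A | A. A \<subseteq> U \<and> indep M A}"
proof -
  have "{card A | A. A \<subseteq> U \<and> indep M A} \<subseteq> card ` Pow (ground M)"
    using indep_ground by blast
  then show ?thesis
    using finite_ground finite_subset by blast
qed

lemma card_le_rk: "indep M A \<Longrightarrow> A \<subseteq> U \<Longrightarrow> card A \<le> rk M U"
  unfolding rk_def by (rule Max_ge[OF finite_indep_cards]) blast

lemma rk_attained: "\<exists>A\<subseteq>U. indep M A \<and> card A = rk M U"
proof -
  have "rk M U \<in> {card A | A. A \<subseteq> U \<and> indep M A}"
    unfolding rk_def by (rule Max_in[OF finite_indep_cards]) (use indep_empty in blast)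
  then show ?thesis by auto
qed

text \<open>Augmenting from a largest independent subset of \<open>U\<close> adds one element of
  \<open>U\<close> at a time, so induction on the missing cardinality applies.\<close>

lemma indep_extend:
  assumes "indep M I" "I \<subseteq> U"
  shows "\<exists>J. indep M J \<and> I \<subseteq> J \<and> J \<subseteq> U \<and> card J = rk M U"
  using assms
proof (induction "rk M U - card I" arbitrary: I rule: less_induct)
  case less
  show ?case
  proof (cases "card I = rk M U")
    case True
    then show ?thesis using less.prems by blast
  next
    case False
    then have lt: "card I < rk M U"
      using card_le_rk[OF less.prems] by simp
    obtain A where A: "A \<subseteq> U" "indep M A" "card A = rk M U"
      using rk_attained by blast
    then obtain x where x: "x \<in> A - I" "indep M (insert x I)"
      using indep_augment[OF less.prems(1) A(2)] lt by auto
    have "card (insert x I) = Suc (card I)"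
      using x finite_indep[OF less.prems(1)] by simp
    then have "rk M U - card (insert x I) < rk M U - card I" "insert x I \<subseteq> U"
      using lt x A(1) less.prems(2) by auto
    then obtain J where "indep M J" "insert x I \<subseteq> J" "J \<subseteq> U" "card J = rk M U"
      using less.hyps[OF _ x(2)] by blast
    then show ?thesis by blast
  qed
qed

lemma rk_le_card: "finite U \<Longrightarrow> rk M U \<le> card U"
  using rk_attained[of U] card_mono by metis

lemma rk_mono: "U \<subseteq> V \<Longrightarrow> rk M U \<le> rk M V"
  using rk_attained[of U] card_le_rk[of _ V] by (metis order_trans)

lemma rk_empty [simp]: "rk M {} = 0"
  using rk_le_card[of "{}"] by simp

lemma rk_le_add_card_diff:
  assumes "V \<subseteq> ground M" "U \<subseteq> V"
  shows "rk M V \<le> rk M U + card (V - U)"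
proof -
  obtain J where J: "J \<subseteq> V" "indep M J" "card J = rk M V"
    using rk_attained by blast
  have fJ: "finite J" using finite_indep J by blast
  have "card J = card (J \<inter> U) + card (J - U)"
    using fJ by (simp add: card_Int_Diff)
  moreover have "card (J \<inter> U) \<le> rk M U"
    using card_le_rk[of "J \<inter> U" U] indep_subset[OF J(2), of "J \<inter> U"] by simp
  moreover have "card (J - U) \<le> card (V - U)"
    using J(1) finite_subset_ground[OF assms(1)] by (intro card_mono) auto
  ultimately show ?thesis using J(3) by linarith
qed

lemma rk_plus_nullity: "U \<subseteq> ground M \<Longrightarrow> rk M U + nullity M U = card U"
  using rk_le_card[of U] finite_subset_ground[of U] by (simp add: nullity_def)

lemma nullity_empty [simp]: "nullity M {} = 0"
  by (simp add: nullity_def)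

lemma nullity_mono:
  assumes "V \<subseteq> ground M" "U \<subseteq> V"
  shows "nullity M U \<le> nullity M V"
proof -
  have "card V = card U + card (V - U)"
    using assms finite_subset_ground[of V] by (metis card_Diff_subset card_mono finite_subset le_add_diff_inverse)
  then show ?thesis
    using rk_le_add_card_diff[OF assms] rk_plus_nullity[OF order_trans[OF assms(2,1)]]
      rk_plus_nullity[OF assms(1)] by simp
qed

text \<open>An element of \<open>U\<close> outside a largest independent subset can be deleted
  without loss of rank, so the nullity drops by exactly one. Iterating this reaches every smaller
  nullity, which makes the minimum in \<open>ghw\<close> range over a nonempty set.\<close>

lemma nullity_Suc_remove:
  assumes "U \<subseteq> ground M" "nullity M U = Suc i"
  shows "\<exists>V. V \<subset> U \<and> nullity M V = i"
proof -
  obtain A where A: "A \<subseteq> U" "indep M A" "card A = rk M U"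
    using rk_attained by blast
  have fU: "finite U" using assms finite_subset_ground by blast
  have "A \<noteq> U" using A(3) rk_plus_nullity[OF assms(1)] assms(2) by auto
  then obtain x where x: "x \<in> U" "x \<notin> A" using A(1) by blast
  have "rk M (U - {x}) = rk M U"
  proof (rule antisym)
    show "rk M (U - {x}) \<le> rk M U" by (rule rk_mono) blast
    show "rk M U \<le> rk M (U - {x})"
      using card_le_rk[OF A(2), of "U - {x}"] A x by auto
  qed
  moreover have "card U = Suc (card (U - {x}))"
    using x fU by (metis card.remove)
  ultimately have "nullity M (U - {x}) = i"
    using rk_plus_nullity[OF assms(1)] rk_plus_nullity[of "U - {x}"] assms by fastforce
  then show ?thesis using x by (intro exI[of _ "U - {x}"]) auto
qed

lemma nullity_decrease:
  assumes "U \<subseteq> ground M" "i \<le> nullity M U"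
  shows "\<exists>V\<subseteq>U. nullity M V = i"
  using assms
proof (induction "nullity M U - i" arbitrary: U)
  case 0
  then show ?case by (intro exI[of _ U]) auto
next
  case (Suc j)
  obtain l where l: "nullity M U = Suc l" using Suc.hyps(2) by (cases "nullity M U") auto
  then obtain V where V: "V \<subset> U" "nullity M V = l"
    using nullity_Suc_remove[OF Suc.prems(1) l] by blast
  have "\<exists>W\<subseteq>V. nullity M W = i"
    by (rule Suc.hyps(1)) (use V l Suc.hyps(2) Suc.prems in auto)
  then show ?case using V by blast
qed

text \<open>Greedy choice: an independent set of full rank in one member is extended to the next.
  Its traces on the earlier members already have full rank, and the extension, being independent,
  cannot exceed it.\<close>

lemma indep_meets_chain:
  assumes "\<And>t. t < N \<Longrightarrow> V t \<subseteq> V (Suc t)"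
  shows "\<exists>I. indep M I \<and> I \<subseteq> V N \<and> (\<forall>t\<le>N. card (I \<inter> V t) = rk M (V t))"
  using assms
proof (induction N)
  case 0
  obtain A where "A \<subseteq> V 0" "indep M A" "card A = rk M (V 0)"
    using rk_attained by blast
  then show ?case by (intro exI[of _ A]) (auto simp: Int_absorb2)
next
  case (Suc N)
  have "\<exists>I. indep M I \<and> I \<subseteq> V N \<and> (\<forall>t\<le>N. card (I \<inter> V t) = rk M (V t))"
    using Suc.prems by (intro Suc.IH) simp
  then obtain I where I: "indep M I" "I \<subseteq> V N" "\<And>t. t \<le> N \<Longrightarrow> card (I \<inter> V t) = rk M (V t)"
    by blast
  obtain J where J: "indep M J" "I \<subseteq> J" "J \<subseteq> V (Suc N)" "card J = rk M (V (Suc N))"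
    using indep_extend[OF I(1), of "V (Suc N)"] I(2) Suc.prems[of N] by auto
  have "card (J \<inter> V t) = rk M (V t)" if t: "t \<le> Suc N" for t
  proof (cases "t = Suc N")
    case True
    then show ?thesis using J by (simp add: Int_absorb2)
  next
    case False
    have "card (I \<inter> V t) \<le> card (J \<inter> V t)"
      using J finite_indep by (intro card_mono) auto
    moreover have "card (J \<inter> V t) \<le> rk M (V t)"
      using indep_subset[OF J(1), of "J \<inter> V t"] by (intro card_le_rk) auto
    ultimately show ?thesis using I(3)[of t] False t by simp
  qed
  then show ?case using J by blast
qed

section \<open>Bases and duality\<close>

lemma bases_iff: "B \<in> bases M \<longleftrightarrow> indep M B \<and> card B = rk M (ground M)"
proof
  assume B: "B \<in> bases M"
  then have iB: "indep M B" by (simp add: bases_def)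
  obtain J where "indep M J" "B \<subseteq> J" "card J = rk M (ground M)"
    using indep_extend[OF iB indep_ground[OF iB]] by blast
  then show "indep M B \<and> card B = rk M (ground M)"
    using B unfolding bases_def by auto
next
  assume B: "indep M B \<and> card B = rk M (ground M)"
  have "A = B" if "indep M A" "B \<subseteq> A" for A
    using that B card_le_rk[OF that(1) indep_ground[OF that(1)]] finite_indep[OF that(1)]
    by (metis card_seteq)
  then show "B \<in> bases M" using B unfolding bases_def by blast
qed

lemma bases_indep: "B \<in> bases M \<Longrightarrow> indep M B"
  by (simp add: bases_def)

lemma bases_ground: "B \<in> bases M \<Longrightarrow> B \<subseteq> ground M"
  using bases_indep indep_ground by blast

lemma indep_extend_base: "indep M I \<Longrightarrow> \<exists>B\<in>bases M. I \<subseteq> B"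
  using indep_extend[of I "ground M"] indep_ground[of I] bases_iff by blast

lemma ground_dual [simp]: "ground (dual M) = ground M"
  by (simp add: dual_def)

lemma indep_dual_iff: "indep (dual M) A \<longleftrightarrow> (\<exists>B\<in>bases M. A \<subseteq> ground M - B)"
  by (simp add: dual_def)

text \<open>Bases form an antichain, hence so do their complements, and each complement is already
  maximal among the subsets of complements.\<close>

lemma bases_dual: "bases (dual M) = (\<lambda>B. ground M - B) ` bases M"
proof (intro subset_antisym subsetI)
  fix X assume X: "X \<in> bases (dual M)"
  then obtain B where B: "B \<in> bases M" "X \<subseteq> ground M - B"
    by (auto simp: bases_def indep_dual_iff)
  moreover have "indep (dual M) (ground M - B)"
    using B(1) indep_dual_iff by blast
  ultimately show "X \<in> (\<lambda>B. ground M - B) ` bases M"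
    using X unfolding bases_def by blast
next
  fix X assume "X \<in> (\<lambda>B. ground M - B) ` bases M"
  then obtain B where B: "B \<in> bases M" "X = ground M - B" by blast
  have "A = X" if A: "indep (dual M) A" "X \<subseteq> A" for A
  proof -
    obtain B' where B': "B' \<in> bases M" "A \<subseteq> ground M - B'"
      using A(1) indep_dual_iff by blast
    have "B' \<subseteq> B"
      using A(2) B B' bases_ground[OF B'(1)] by blast
    then have "B' = B"
      using B(1) B'(1) unfolding bases_def by blast
    then show ?thesis using A B B' by blast
  qed
  moreover have "indep (dual M) X"
    using B indep_dual_iff by blast
  ultimately show "X \<in> bases (dual M)"
    unfolding bases_def by blast
qed

lemma matroid_dual: "matroid (dual M)"
proof
  show "finite (ground (dual M))" by (simp add: finite_ground)
  show "A \<subseteq> ground (dual M)" if "indep (dual M) A" for A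
    using that by (auto simp: indep_dual_iff)
  show "indep (dual M) {}"
    using indep_extend_base[OF indep_empty] by (auto simp: indep_dual_iff)
  show "indep (dual M) B" if "indep (dual M) A" "B \<subseteq> A" for A B
    using that by (auto simp: indep_dual_iff)
  show "\<exists>x\<in>X - A. indep (dual M) (insert x A)"
    if iA: "indep (dual M) A" and iX: "indep (dual M) X" and lt: "card A < card X" for A X
  proof -
    let ?E = "ground M"
    obtain B1 where B1: "B1 \<in> bases M" "A \<subseteq> ?E - B1" using iA indep_dual_iff by blast
    obtain B2 where B2: "B2 \<in> bases M" "X \<subseteq> ?E - B2" using iX indep_dual_iff by blast
    \<comment> \<open>\<open>C\<close> is a largest independent set avoiding both \<open>A\<close>
      and \<open>X\<close>. The complements of \<open>A\<close> and of \<open>X\<close> have full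
      rank because they contain \<open>B1\<close> and \<open>B2\<close>, so \<open>C\<close> extends
      to a basis \<open>C1\<close> avoiding \<open>A\<close> and a basis \<open>C2\<close> avoiding
      \<open>X\<close>.\<close>
    obtain C where C: "C \<subseteq> ?E - (A \<union> X)" "indep M C" "card C = rk M (?E - (A \<union> X))"
      using rk_attained by blast
    have "rk M ?E \<le> rk M (?E - A)"
      using card_le_rk[OF bases_indep[OF B1(1)], of "?E - A"] B1 bases_iff bases_ground[OF B1(1)] by auto
    then have rA: "rk M (?E - A) = rk M ?E" using rk_mono[of "?E - A" ?E] by auto
    have "rk M ?E \<le> rk M (?E - X)"
      using card_le_rk[OF bases_indep[OF B2(1)], of "?E - X"] B2 bases_iff bases_ground[OF B2(1)] by auto
    then have rX: "rk M (?E - X) = rk M ?E" using rk_mono[of "?E - X" ?E] by auto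
    obtain C1 where C1: "indep M C1" "C \<subseteq> C1" "C1 \<subseteq> ?E - A" "card C1 = rk M ?E"
      using indep_extend[OF C(2), of "?E - A"] C(1) rA by auto
    obtain C2 where C2: "indep M C2" "C \<subseteq> C2" "C2 \<subseteq> ?E - X" "card C2 = rk M ?E"
      using indep_extend[OF C(2), of "?E - X"] C(1) rX by auto
    have bC1: "C1 \<in> bases M" using C1 bases_iff by blast
    have fin: "finite A" "finite X" "finite C" "finite C1" "finite C2"
      using B1 B2 C C1 C2 finite_ground by (auto intro: finite_indep finite_subset[of A] finite_subset[of X])
    show ?thesis
    proof (cases "X - A \<subseteq> C1")
      case False
      then obtain x where x: "x \<in> X - A" "x \<notin> C1" by blast
      then have "insert x A \<subseteq> ?E - C1" using C1 B1 B2 by blast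
      then show ?thesis using bC1 x indep_dual_iff by blast
    next
      case True
      \<comment> \<open>A count excludes this case: maximality of \<open>C\<close> forces
        \<open>C2\<close> into \<open>C \<union> (A - X)\<close>, which is smaller than
        \<open>C \<union> (X - A) \<subseteq> C1\<close>, although \<open>C1\<close> and
        \<open>C2\<close> have the same size.\<close>
      have "card (C2 \<inter> (?E - (A \<union> X))) \<le> card C"
        using card_le_rk[of "C2 \<inter> (?E - (A \<union> X))" "?E - (A \<union> X)"] C(3) indep_subset[OF C2(1)] by auto
      moreover have "C \<subseteq> C2 \<inter> (?E - (A \<union> X))" using C C2 by blast
      ultimately have "C = C2 \<inter> (?E - (A \<union> X))" using fin by (intro card_seteq) auto
      then have "C2 \<subseteq> C \<union> (A - X)" using C2(3) by blast
      then have "card C2 \<le> card (C \<union> (A - X))" using fin by (intro card_mono) auto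
      also have "\<dots> \<le> card C + card (A - X)" by (rule card_Un_le)
      finally have 1: "card C2 \<le> card C + card (A - X)" .
      have "card (C \<union> (X - A)) \<le> card C1" using True C1 fin by (intro card_mono) auto
      moreover have "card (C \<union> (X - A)) = card C + card (X - A)"
        using C(1) fin by (intro card_Un_disjoint) auto
      ultimately have 2: "card C + card (X - A) \<le> card C1" by simp
      have "card A = card (A \<inter> X) + card (A - X)" "card X = card (X \<inter> A) + card (X - A)"
        using fin by (simp_all add: card_Int_Diff)
      then have "card (A - X) < card (X - A)" using lt by (simp add: Int_commute)
      then show ?thesis using 1 2 C1(4) C2(4) by linarith
    qed
  qed
qed

lemma dual_dual: "dual (dual M) = M"
proof -
  have "(\<exists>B\<in>bases (dual M). A \<subseteq> ground M - B) \<longleftrightarrow> indep M A" for A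
  proof -
    have "ground M - (ground M - B) = B" if "B \<in> bases M" for B
      using bases_ground[OF that] by (rule double_diff) simp
    then have "(\<exists>B\<in>bases (dual M). A \<subseteq> ground M - B) \<longleftrightarrow> (\<exists>B\<in>bases M. A \<subseteq> B)"
      unfolding bases_dual by simp
    also have "\<dots> \<longleftrightarrow> indep M A"
      using indep_extend_base[of A] bases_indep indep_subset by blast
    finally show ?thesis .
  qed
  then show ?thesis
    unfolding dual_def[of "dual M"] by simp
qed

text \<open>Every basis divides its elements between \<open>U\<close> and the complement of
  \<open>U\<close>. A basis through a largest independent subset of the complement gives one
  inequality, a basis avoiding a largest dual-independent subset of \<open>U\<close> the
  other.\<close>

lemma rk_dual:
  assumes "U \<subseteq> ground M"
  shows "rk (dual M) U + rk M (ground M) = card U + rk M (ground M - U)"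
proof -
  let ?E = "ground M"
  interpret D: matroid "dual M" by (rule matroid_dual)
  have fU: "finite U" using assms finite_subset_ground by blast
  have split: "rk M ?E = card (B \<inter> U) + card (B \<inter> (?E - U))" if "B \<in> bases M" for B
  proof -
    have "B \<inter> (?E - U) = B - U" using bases_ground[OF that] by blast
    then show ?thesis using that bases_iff[of B] finite_indep[of B] card_Int_Diff[of B U] by simp
  qed
  obtain I where I: "I \<subseteq> ?E - U" "indep M I" "card I = rk M (?E - U)"
    using rk_attained by blast
  obtain B where B: "B \<in> bases M" "I \<subseteq> B" using indep_extend_base[OF I(2)] by blast
  have "indep (dual M) (U - B)" using B assms indep_dual_iff by blast
  then have "card (U - B) \<le> rk (dual M) U" by (rule D.card_le_rk) blast
  moreover have "card U = card (U \<inter> B) + card (U - B)" using fU by (simp add: card_Int_Diff)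
  moreover have "card I \<le> card (B \<inter> (?E - U))"
    using I B finite_ground by (intro card_mono) auto
  ultimately have ge: "card U + rk M (?E - U) \<le> rk (dual M) U + rk M ?E"
    using split[OF B(1)] I(3) by (simp add: Int_commute)
  obtain A where A: "A \<subseteq> U" "indep (dual M) A" "card A = rk (dual M) U"
    using D.rk_attained by blast
  obtain B' where B': "B' \<in> bases M" "A \<subseteq> ?E - B'" using A(2) indep_dual_iff by blast
  have "card A \<le> card (U - B')" using A B' fU by (intro card_mono) auto
  moreover have "card U = card (U \<inter> B') + card (U - B')" using fU by (simp add: card_Int_Diff)
  moreover have "card (B' \<inter> (?E - U)) \<le> rk M (?E - U)"
    using indep_subset[OF bases_indep[OF B'(1)], of "B' \<inter> (?E - U)"] by (intro card_le_rk) auto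
  ultimately have "rk (dual M) U + rk M ?E \<le> card U + rk M (?E - U)"
    using split[OF B'(1)] A(3) by (simp add: Int_commute)
  then show ?thesis using ge by simp
qed

lemma rk_dual_ground: "rk (dual M) (ground M) + rk M (ground M) = card (ground M)"
  using rk_dual[of "ground M"] by simp

lemma nullity_ground_dual: "nullity (dual M) (ground M) = rk M (ground M)"
  using rk_dual_ground unfolding nullity_def by linarith

text \<open>Complementation turns nullity in \<open>M\<close> into corank in the dual; this is what
  relates \<open>ghw\<close> to \<open>fmax\<close>.\<close>

lemma nullity_compl:
  assumes "F \<subseteq> ground M"
  shows "nullity M (ground M - F) + rk (dual M) F = nullity M (ground M)"
proof -
  have "card (ground M) = card F + card (ground M - F)"
    using assms finite_ground by (metis card_Diff_subset card_mono finite_subset le_add_diff_inverse)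
  then show ?thesis
    using rk_dual[OF assms] rk_plus_nullity[of "ground M"] rk_plus_nullity[of "ground M - F"] by auto
qed

text \<open>\<open>B\<close> is the complement of a basis, and that basis meets \<open>U\<close> in
  an independent set, of size at most \<open>rk M U\<close>. For ideals: the squarefree monomial of
  \<open>U\<close> lies in the power of \<open>P_B\<close> with exponent
  \<open>nullity M U\<close>.\<close>

lemma nullity_le_card_base_dual:
  assumes "B \<in> bases (dual M)" "U \<subseteq> ground M"
  shows "nullity M U \<le> card (B \<inter> U)"
proof -
  obtain B' where B': "B' \<in> bases M" "B = ground M - B'" using assms(1) bases_dual by blast
  have "card (U \<inter> B') \<le> rk M U"
    using indep_subset[OF bases_indep[OF B'(1)], of "U \<inter> B'"] by (intro card_le_rk) auto
  moreover have "card U = card (U \<inter> B') + card (U - B')"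
    using finite_subset_ground[OF assms(2)] by (simp add: card_Int_Diff)
  moreover have "U - B' = B \<inter> U" using B' assms(2) by blast
  ultimately show ?thesis using rk_plus_nullity[OF assms(2)] by simp
qed

text \<open>A basis through the greedy independent set contains at least \<open>rk M (V t)\<close>
  elements of each \<open>V t\<close>, so its complement contains at most the nullity; the preceding
  bound gives equality.\<close>

lemma base_dual_meets_chain:
  assumes "\<And>t. t \<le> N \<Longrightarrow> V t \<subseteq> ground M" "\<And>t. t < N \<Longrightarrow> V t \<subseteq> V (Suc t)"
  shows "\<exists>B\<in>bases (dual M). \<forall>t\<le>N. card (B \<inter> V t) = nullity M (V t)"
proof -
  obtain I where I: "indep M I" "\<And>t. t \<le> N \<Longrightarrow> card (I \<inter> V t) = rk M (V t)"
    using indep_meets_chain[of N V] assms(2) by blast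
  obtain B' where B': "B' \<in> bases M" "I \<subseteq> B'" using indep_extend_base[OF I(1)] by blast
  let ?B = "ground M - B'"
  have B: "?B \<in> bases (dual M)" using B'(1) bases_dual by blast
  have "card (?B \<inter> V t) \<le> nullity M (V t)" if t: "t \<le> N" for t
  proof -
    have fV: "finite (V t)" using assms(1)[OF t] finite_subset_ground by blast
    have "card (I \<inter> V t) \<le> card (V t \<inter> B')"
      using B' fV by (intro card_mono) auto
    moreover have "card (V t) = card (V t \<inter> B') + card (V t - B')"
      using fV by (simp add: card_Int_Diff)
    moreover have "V t - B' = ?B \<inter> V t" using assms(1)[OF t] by blast
    ultimately show ?thesis using rk_plus_nullity[OF assms(1)[OF t]] I(2)[OF t] by simp
  qed
  then show ?thesis using B nullity_le_card_base_dual[OF B assms(1)] le_antisym by blast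
qed

section \<open>Generalized Hamming weights\<close>

lemma ghw_nullity: "ghw M r = Min {card U | U. U \<subseteq> ground M \<and> nullity M U = r}"
  by (simp add: ghw_def nullity_def)

lemma finite_cards: "finite {card U | U. U \<subseteq> ground M \<and> P U}"
proof -
  have "{card U | U. U \<subseteq> ground M \<and> P U} \<subseteq> card ` Pow (ground M)" by blast
  then show ?thesis using finite_ground finite_subset by blast
qed

lemma ghw_le_card: "U \<subseteq> ground M \<Longrightarrow> ghw M (nullity M U) \<le> card U"
  unfolding ghw_nullity by (rule Min_le[OF finite_cards]) blast

lemma ghw_attained:
  assumes "r \<le> nullity M (ground M)"
  shows "\<exists>U\<subseteq>ground M. nullity M U = r \<and> card U = ghw M r"
proof -
  have "ghw M r \<in> {card U | U. U \<subseteq> ground M \<and> nullity M U = r}"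
    unfolding ghw_nullity
    by (rule Min_in[OF finite_cards]) (use nullity_decrease[OF subset_refl assms] in blast)
  then show ?thesis by auto
qed

lemma ghw_0 [simp]: "ghw M 0 = 0"
  using ghw_le_card[of "{}"] by simp

text \<open>A smallest set of nullity \<open>Suc r\<close> has a proper subset of nullity
  \<open>r\<close>.\<close>

lemma ghw_less_Suc:
  assumes "Suc r \<le> nullity M (ground M)"
  shows "ghw M r < ghw M (Suc r)"
proof -
  obtain U where U: "U \<subseteq> ground M" "nullity M U = Suc r" "card U = ghw M (Suc r)"
    using ghw_attained[OF assms] by blast
  obtain V where V: "V \<subset> U" "nullity M V = r" using nullity_Suc_remove[OF U(1,2)] by blast
  have "ghw M r \<le> card V" using ghw_le_card[of V] U V by auto
  also have "\<dots> < card U" using V U finite_subset_ground by (intro psubset_card_mono) auto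
  finally show ?thesis using U by simp
qed

lemma ghw_less: "r < r' \<Longrightarrow> r' \<le> nullity M (ground M) \<Longrightarrow> ghw M r < ghw M r'"
proof (induction r')
  case (Suc r')
  then show ?case using ghw_less_Suc[of r'] by (cases "r = r'") auto
qed simp

lemma ghw_mono: "r \<le> r' \<Longrightarrow> r' \<le> nullity M (ground M) \<Longrightarrow> ghw M r \<le> ghw M r'"
  using ghw_less[of r r'] by (cases "r = r'") auto

lemma ghw_le_card_ground: "r \<le> nullity M (ground M) \<Longrightarrow> ghw M r \<le> card (ground M)"
  using ghw_attained[of r] card_mono[OF finite_ground] by metis

lemma le_nullity_imp_ghw_le_card:
  assumes "U \<subseteq> ground M" "r \<le> nullity M U"
  shows "ghw M r \<le> card U"
  using ghw_mono[OF assms(2) nullity_mono[OF subset_refl assms(1)]] ghw_le_card[OF assms(1)] by simp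

text \<open>If a set of full nullity missed \<open>x\<close>, a basis avoiding \<open>x\<close>
  would show that deleting \<open>x\<close> from the ground set keeps the rank and so lowers the
  nullity, against monotonicity.\<close>

lemma ghw_nullity_ground:
  assumes "\<nexists>x. coloop M x"
  shows "ghw M (nullity M (ground M)) = card (ground M)"
proof -
  let ?E = "ground M"
  obtain U where U: "U \<subseteq> ?E" "nullity M U = nullity M ?E" "card U = ghw M (nullity M ?E)"
    using ghw_attained by blast
  have "U = ?E"
  proof (rule ccontr)
    assume "U \<noteq> ?E"
    then obtain x where x: "x \<in> ?E" "x \<notin> U" using U(1) by blast
    then obtain B where B: "B \<in> bases M" "x \<notin> B" using assms unfolding coloop_def by blast
    have "nullity M ?E \<le> nullity M (?E - {x})"
      using nullity_mono[of "?E - {x}" U] U x by auto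
    moreover have "rk M ?E \<le> rk M (?E - {x})"
      using card_le_rk[OF bases_indep[OF B(1)], of "?E - {x}"] B bases_iff bases_ground[OF B(1)] by auto
    moreover have "card ?E = Suc (card (?E - {x}))" using x finite_ground by (metis card.remove)
    ultimately show False
      using rk_plus_nullity[of ?E] rk_plus_nullity[of "?E - {x}"] by auto
  qed
  then show ?thesis using U by simp
qed

text \<open>A non-loop lies in a basis, whose complement is a basis of the dual avoiding it. Absence
  of loops in \<open>M\<close> thus determines the top weight of the dual.\<close>

lemma coloop_dual: "coloop (dual M) x \<Longrightarrow> loop M x"
  using indep_extend_base[of "{x}"] by (auto simp: coloop_def loop_def bases_dual)

text \<open>The sets of dual rank \<open>j\<close> are the complements of the sets of nullity
  \<open>nullity M (ground M) - j\<close>, so a largest one of the former is the complement of a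
  smallest one of the latter.\<close>

lemma ghw_fmax_dual:
  assumes "j \<le> nullity M (ground M)"
  shows "ghw M (nullity M (ground M) - j) + fmax (dual M) j = card (ground M)"
proof -
  let ?E = "ground M" let ?\<nu> = "nullity M ?E"
  interpret D: matroid "dual M" by (rule matroid_dual)
  have split: "card ?E = card F + card (?E - F)" if "F \<subseteq> ?E" for F
    using that finite_ground by (metis card_Diff_subset card_mono finite_subset le_add_diff_inverse)
  obtain U where U: "U \<subseteq> ?E" "nullity M U = ?\<nu> - j" "card U = ghw M (?\<nu> - j)"
    using ghw_attained[of "?\<nu> - j"] by auto
  have fin: "finite {card F | F. F \<subseteq> ?E \<and> rk (dual M) F = j}" by (rule finite_cards)
  have "?E - (?E - U) = U" using U(1) by blast
  then have rkU: "rk (dual M) (?E - U) = j" using nullity_compl[of "?E - U"] U(2) assms by simp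
  then have mem: "card (?E - U) \<in> {card F | F. F \<subseteq> ?E \<and> rk (dual M) F = j}" by blast
  have "fmax (dual M) j = card (?E - U)"
    unfolding fmax_def ground_dual
  proof (rule Max_eqI[OF fin _ mem])
    fix y assume "y \<in> {card F | F. F \<subseteq> ?E \<and> rk (dual M) F = j}"
    then obtain F where F: "F \<subseteq> ?E" "rk (dual M) F = j" "y = card F" by blast
    have "nullity M (?E - F) = ?\<nu> - j" using nullity_compl[OF F(1)] F(2) by simp
    then have "ghw M (?\<nu> - j) \<le> card (?E - F)" using ghw_le_card[of "?E - F"] by auto
    then show "y \<le> card (?E - U)" using split[OF F(1)] split[OF U(1)] U(3) F(3) by linarith
  qed
  then show ?thesis using split[OF U(1)] U(3) by simp
qed

end

section \<open>Subadditivity and the minimal cost of a decomposition\<close>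

text \<open>Decompositions are lists, as in \<open>subadditive_term\<close>, so that parts can be
  appended, refined and truncated; \<open>multiplicity_costs\<close> passes to the tuples of
  (d).\<close>

definition costs :: "nat set \<Rightarrow> (nat \<Rightarrow> nat) \<Rightarrow> nat \<Rightarrow> nat set" where
  "costs A d s = {\<Sum>a\<leftarrow>as. d a | as. set as \<subseteq> A \<and> sum_list as = s}"

abbreviation min_cost :: "nat \<Rightarrow> (nat \<Rightarrow> nat) \<Rightarrow> nat \<Rightarrow> nat" where
  "min_cost m d s \<equiv> Min (costs {1..m} d s)"

lemma costsI: "set as \<subseteq> A \<Longrightarrow> sum_list as = s \<Longrightarrow> (\<Sum>a\<leftarrow>as. d a) \<in> costs A d s"
  by (auto simp: costs_def)

lemma sum_list_concat_replicate:
  "(\<Sum>a\<leftarrow>concat (map (\<lambda>i. replicate (b i) i) [1..<Suc m]). f a) = (\<Sum>i=1..m. b i * f i)"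
  for f :: "nat \<Rightarrow> nat"
  by (induction m) (auto simp: sum_list_replicate)

text \<open>A tuple becomes the list with \<open>b i\<close> copies of each \<open>i\<close>, and a
  list becomes its tuple of multiplicities. The predicate \<open>P\<close> serves the full and the
  restricted minimum at once.\<close>

lemma multiplicity_costs:
  "{\<Sum>i=1..m. b i * d i | b :: nat \<Rightarrow> nat. (\<Sum>i=1..m. i * b i) = s \<and>
      (\<forall>i\<in>{1..m}. b i > 0 \<longrightarrow> P i)} = costs {i \<in> {1..m}. P i} d s"
    (is "?L = ?R")
proof (intro subset_antisym subsetI)
  fix x assume "x \<in> ?L"
  then obtain b where b: "x = (\<Sum>i=1..m. b i * d i)" "(\<Sum>i=1..m. i * b i) = s"
      "\<forall>i\<in>{1..m}. b i > 0 \<longrightarrow> P i" by blast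
  let ?as = "concat (map (\<lambda>i. replicate (b i) i) [1..<Suc m])"
  have "set ?as \<subseteq> {i \<in> {1..m}. P i}" using b(3) by (auto split: if_splits)
  moreover have "sum_list ?as = s"
    using sum_list_concat_replicate[where b = b and m = m and f = "\<lambda>i. i"] b(2) by (simp add: mult.commute)
  ultimately show "x \<in> ?R"
    unfolding b(1) sum_list_concat_replicate[where b = b and m = m and f = d, symmetric]
    by (rule costsI)
next
  fix x assume "x \<in> ?R"
  then obtain as where as: "x = (\<Sum>a\<leftarrow>as. d a)" "set as \<subseteq> {i \<in> {1..m}. P i}" "sum_list as = s"
    by (auto simp: costs_def)
  have sub: "set as \<subseteq> {1..m}" using as(2) by blast
  have sum: "(\<Sum>a\<leftarrow>as. f a) = (\<Sum>i=1..m. count_list as i * f i)" for f :: "nat \<Rightarrow> nat"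
    by (rule sum_list_map_eq_sum_count2[OF sub]) simp
  have "(\<Sum>i=1..m. i * count_list as i) = s"
    using sum[of "\<lambda>i. i"] as(3) by (simp add: mult.commute)
  moreover have "\<forall>i\<in>{1..m}. count_list as i > 0 \<longrightarrow> P i"
  proof (intro ballI impI)
    fix i assume "count_list as i > 0"
    then have "i \<in> set as" by (metis count_list_0_iff less_numeral_extra(3))
    then show "P i" using as(2) by blast
  qed
  ultimately show "x \<in> ?L" using as(1) sum[of d] by blast
qed

lemma finite_costs:
  assumes "A \<subseteq> {1..m}"
  shows "finite (costs A d s)"
proof -
  \<comment> \<open>All parts are positive, so a decomposition of \<open>s\<close> has at most
    \<open>s\<close> of them.\<close>
  have len: "length as \<le> sum_list as" if "set as \<subseteq> A" for as
    using that assms by (induction as) force+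
  have "costs A d s \<subseteq> (\<lambda>as. \<Sum>a\<leftarrow>as. d a) ` {as. set as \<subseteq> {1..m} \<and> length as \<le> s}"
  proof
    fix x assume "x \<in> costs A d s"
    then obtain as where "x = (\<Sum>a\<leftarrow>as. d a)" "set as \<subseteq> A" "sum_list as = s"
      by (auto simp: costs_def)
    then show "x \<in> (\<lambda>as. \<Sum>a\<leftarrow>as. d a) ` {as. set as \<subseteq> {1..m} \<and> length as \<le> s}"
      using len[of as] assms by blast
  qed
  then show ?thesis
    using finite_lists_length_le[of "{1..m}" s] finite_surj by blast
qed

lemma min_cost_le:
  "set as \<subseteq> {1..m} \<Longrightarrow> min_cost m d (sum_list as) \<le> (\<Sum>a\<leftarrow>as. d a)"
  by (intro Min_le finite_costs[OF subset_refl] costsI) auto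

lemma min_cost_attained:
  assumes "m \<ge> 1"
  shows "\<exists>as. set as \<subseteq> {1..m} \<and> sum_list as = s \<and> (\<Sum>a\<leftarrow>as. d a) = min_cost m d s"
proof -
  \<comment> \<open>The decomposition into ones shows that the set of costs is nonempty; this is
    where \<open>m \<ge> 1\<close> enters.\<close>
  have "(\<Sum>a\<leftarrow>replicate s 1. d a) \<in> costs {1..m} d s"
    using assms by (intro costsI) (auto simp: sum_list_replicate)
  then have "min_cost m d s \<in> costs {1..m} d s"
    by (intro Min_in finite_costs[OF subset_refl]) auto
  then show ?thesis unfolding costs_def by (elim CollectE exE) metis
qed

lemma min_cost_eq_iff_subadditive_term:
  assumes "s \<in> {1..m}"
  shows "min_cost m d s = d s \<longleftrightarrow> subadditive_term m d s"
proof
  assume eq: "min_cost m d s = d s"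
  show "subadditive_term m d s"
    unfolding subadditive_term_def using eq min_cost_le by metis
next
  assume sub: "subadditive_term m d s"
  have "m \<ge> 1" using assms by simp
  then obtain as where as: "set as \<subseteq> {1..m}" "sum_list as = s" "(\<Sum>a\<leftarrow>as. d a) = min_cost m d s"
    using min_cost_attained by blast
  \<comment> \<open>The empty list, for which \<open>subadditive_term\<close> gives no bound, is
    excluded by \<open>s \<ge> 1\<close>.\<close>
  have "as \<noteq> []" using as(2) assms by auto
  then have "length as \<ge> 1" by (simp add: Suc_leI)
  then have "d s \<le> min_cost m d s"
    using sub as unfolding subadditive_term_def by metis
  moreover have "min_cost m d s \<le> d s"
    using min_cost_le[of "[s]" m d] assms by simp
  ultimately show "min_cost m d s = d s" by simp
qed

lemma refine_list:
  fixes d :: "nat \<Rightarrow> nat"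
  assumes "\<And>a. a \<in> set as \<Longrightarrow> \<exists>bs. set bs \<subseteq> B \<and> sum_list bs = a \<and> (\<Sum>b\<leftarrow>bs. d b) \<le> d a"
  shows "\<exists>bs. set bs \<subseteq> B \<and> sum_list bs = sum_list as \<and> (\<Sum>b\<leftarrow>bs. d b) \<le> (\<Sum>a\<leftarrow>as. d a)"
  using assms
proof (induction as)
  case Nil
  then show ?case by (intro exI[of _ "[]"]) simp
next
  case (Cons a as)
  obtain bs where "set bs \<subseteq> B" "sum_list bs = a" "(\<Sum>b\<leftarrow>bs. d b) \<le> d a"
    using Cons.prems[of a] by auto
  moreover have "\<exists>cs. set cs \<subseteq> B \<and> sum_list cs = sum_list as \<and> (\<Sum>b\<leftarrow>cs. d b) \<le> (\<Sum>a\<leftarrow>as. d a)"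
    using Cons.prems by (intro Cons.IH) simp
  then obtain cs where "set cs \<subseteq> B" "sum_list cs = sum_list as"
      "(\<Sum>b\<leftarrow>cs. d b) \<le> (\<Sum>a\<leftarrow>as. d a)" by blast
  ultimately show ?case by (intro exI[of _ "bs @ cs"]) auto
qed

text \<open>Strong induction on \<open>a\<close>: a term that is not strictly subadditive can be
  replaced by at least two parts of no larger total cost, and these are smaller than
  \<open>a\<close> because all parts are positive.\<close>

lemma split_into_strictly_subadditive_terms:
  assumes "a \<in> {1..m}"
  shows "\<exists>bs. set bs \<subseteq> {i \<in> {1..m}. strictly_subadditive_term m d i} \<and> sum_list bs = a \<and>
    (\<Sum>b\<leftarrow>bs. d b) \<le> d a"
  using assms
proof (induction a rule: less_induct)
  case (less a)
  show ?case
  proof (cases "strictly_subadditive_term m d a")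
    case True
    then show ?thesis using less.prems by (intro exI[of _ "[a]"]) auto
  next
    case False
    then obtain as where as: "length as \<ge> 2" "set as \<subseteq> {1..m}" "sum_list as = a"
        "(\<Sum>a\<leftarrow>as. d a) \<le> d a"
      unfolding strictly_subadditive_term_def by (auto simp: not_less)
    have smaller: "x < a" if "x \<in> set as" for x
    proof -
      obtain ys zs where split: "as = ys @ x # zs" using \<open>x \<in> set as\<close> by (meson split_list)
      have "ys @ zs \<noteq> []" using as(1) split by auto
      then obtain y where y: "y \<in> set (ys @ zs)" by (meson ex_in_conv set_empty)
      then have "y \<ge> 1" using as(2) split by auto
      moreover have "y \<le> sum_list (ys @ zs)" by (rule member_le_sum_list[OF y]) simp
      ultimately show ?thesis using as(3) split by auto
    qed
    have "\<exists>bs. set bs \<subseteq> {i \<in> {1..m}. strictly_subadditive_term m d i} \<and>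
        sum_list bs = sum_list as \<and> (\<Sum>b\<leftarrow>bs. d b) \<le> (\<Sum>a\<leftarrow>as. d a)"
      by (rule refine_list) (use less.IH smaller as(2) in blast)
    then show ?thesis using as(3,4) order_trans by metis
  qed
qed

lemma min_cost_strictly_subadditive_terms:
  assumes "m \<ge> 1"
  shows "min_cost m d s = Min (costs {i \<in> {1..m}. strictly_subadditive_term m d i} d s)"
    (is "_ = Min (costs ?A d s)")
proof -
  have fin: "finite (costs ?A d s)" by (rule finite_costs[of _ m]) blast
  obtain as where as: "set as \<subseteq> {1..m}" "sum_list as = s" "(\<Sum>a\<leftarrow>as. d a) = min_cost m d s"
    using min_cost_attained[OF assms] by blast
  have "\<exists>bs. set bs \<subseteq> ?A \<and> sum_list bs = sum_list as \<and> (\<Sum>b\<leftarrow>bs. d b) \<le> (\<Sum>a\<leftarrow>as. d a)"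
    by (rule refine_list) (use split_into_strictly_subadditive_terms as(1) in blast)
  then obtain bs where bs: "set bs \<subseteq> ?A" "sum_list bs = s" "(\<Sum>b\<leftarrow>bs. d b) \<le> min_cost m d s"
    using as by auto
  have mem: "(\<Sum>b\<leftarrow>bs. d b) \<in> costs ?A d s" using bs by (intro costsI)
  have "Min (costs ?A d s) \<le> min_cost m d s"
    using Min_le[OF fin mem] bs(3) by simp
  moreover have "costs ?A d s \<subseteq> costs {1..m} d s" unfolding costs_def by blast
  then have "min_cost m d s \<le> Min (costs ?A d s)"
    using mem by (intro Min_antimono finite_costs[OF subset_refl]) auto
  ultimately show ?thesis by simp
qed

text \<open>The least ratio \<open>c\<close> bounds the cost of every part from below, and using as
  many copies as possible of an index attaining \<open>c\<close> is nearly optimal.\<close>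

lemma min_cost_ratio_tendsto:
  assumes "m \<ge> 1"
  shows "(\<lambda>s. real (min_cost m d s) / real s) \<longlonglongrightarrow> (MIN i\<in>{1..m}. real (d i) / real i)"
proof -
  let ?r = "\<lambda>i. real (d i) / real i"
  define c where "c = (MIN i\<in>{1..m}. ?r i)"
  have "c \<in> ?r ` {1..m}" unfolding c_def using assms by (intro Min_in) auto
  then obtain i where i: "i \<in> {1..m}" "c = ?r i" by blast
  have c_le: "c * real a \<le> real (d a)" if a: "a \<in> {1..m}" for a
  proof -
    have "c \<le> ?r a" unfolding c_def using that by (intro Min_le) auto
    then show ?thesis using a by (simp add: pos_le_divide_eq)
  qed
  have lower: "c \<le> real (min_cost m d s) / real s" if "s > 0" for s
  proof -
    obtain as where as: "set as \<subseteq> {1..m}" "sum_list as = s" "(\<Sum>a\<leftarrow>as. d a) = min_cost m d s"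
      using min_cost_attained[OF assms] by blast
    have "c * real (sum_list as) \<le> real (\<Sum>a\<leftarrow>as. d a)"
      using as(1) by (induction as) (use c_le in \<open>fastforce simp: distrib_left\<close>)+
    then show ?thesis using that as by (simp add: pos_le_divide_eq)
  qed
  have upper: "real (min_cost m d s) / real s \<le> c + real (i * d 1) / real s" if "s > 0" for s
  proof -
    \<comment> \<open>The remainder is filled with ones. This costs at most \<open>i * d 1\<close>
      whatever \<open>s\<close> is, an error that vanishes after division by
      \<open>s\<close>.\<close>
    let ?as = "replicate (s div i) i @ replicate (s mod i) 1"
    have "sum_list ?as = s" by (simp add: sum_list_replicate)
    moreover have "set ?as \<subseteq> {1..m}" using i assms by auto
    ultimately have "min_cost m d s \<le> (\<Sum>a\<leftarrow>?as. d a)"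
      using min_cost_le[of ?as m d] by simp
    also have "\<dots> = s div i * d i + s mod i * d 1"
      by (simp add: sum_list_replicate)
    also have "\<dots> \<le> s div i * d i + i * d 1"
      using i(1) by (intro add_left_mono mult_right_mono) (auto intro: less_imp_le)
    finally have "real (min_cost m d s) \<le> real (s div i) * real (d i) + real (i * d 1)"
      by (metis of_nat_add of_nat_le_iff of_nat_mult)
    also have "real (s div i) * real (d i) \<le> real s / real i * real (d i)"
      by (intro mult_right_mono of_nat_div_le_of_nat) simp
    also have "real s / real i * real (d i) = c * real s" using i by simp
    finally have "real (min_cost m d s) / real s \<le> (c * real s + real (i * d 1)) / real s"
      by (intro divide_right_mono) simp_all
    then show ?thesis using that by (simp add: add_divide_distrib del: of_nat_mult)
  qed
  have lim: "(\<lambda>s. c + real (i * d 1) / real s) \<longlonglongrightarrow> c"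
    using tendsto_add[OF tendsto_const lim_const_over_n, of c "real (i * d 1)"] by simp
  have "(\<lambda>s. real (min_cost m d s) / real s) \<longlonglongrightarrow> c"
  proof (rule tendsto_sandwich[OF _ _ tendsto_const lim])
    show "\<forall>\<^sub>F s in sequentially. c \<le> real (min_cost m d s) / real s"
      using eventually_gt_at_top[of 0] by (rule eventually_mono) (rule lower)
    show "\<forall>\<^sub>F s in sequentially. real (min_cost m d s) / real s \<le> c + real (i * d 1) / real s"
      using eventually_gt_at_top[of 0] by (rule eventually_mono) (rule upper)
  qed
  then show ?thesis unfolding c_def .
qed

text \<open>Peeling off the head of a list reduces the general inequality to two parts, since the
  sums of its tails stay in \<open>{1..m}\<close>.\<close>

lemma subadditive_iff_pairs:
  "subadditive m d \<longleftrightarrow> (\<forall>a\<ge>1. \<forall>b\<ge>1. a + b \<le> m \<longrightarrow> d (a + b) \<le> d a + d b)"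
proof
  assume sub: "subadditive m d"
  show "\<forall>a\<ge>1. \<forall>b\<ge>1. a + b \<le> m \<longrightarrow> d (a + b) \<le> d a + d b"
  proof (intro allI impI)
    fix a b :: nat assume ab: "a \<ge> 1" "b \<ge> 1" "a + b \<le> m"
    have "d (a + b) \<le> (\<Sum>x\<leftarrow>[a, b]. d x)"
      using ab sub unfolding subadditive_def subadditive_term_def
      by (auto dest!: bspec[of _ _ "a + b"] spec[of _ "[a, b]"])
    then show "d (a + b) \<le> d a + d b" by simp
  qed
next
  assume pairs: "\<forall>a\<ge>1. \<forall>b\<ge>1. a + b \<le> m \<longrightarrow> d (a + b) \<le> d a + d b"
  have "d (sum_list as) \<le> (\<Sum>a\<leftarrow>as. d a)"
    if "as \<noteq> []" "set as \<subseteq> {1..m}" "sum_list as \<le> m" for as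
    using that
  proof (induction as rule: list_nonempty_induct)
    case (cons a as)
    have "sum_list as \<ge> 1"
      using cons.hyps cons.prems by (cases as) auto
    then have "d (a + sum_list as) \<le> d a + d (sum_list as)"
      using cons.prems pairs by auto
    then show ?case using cons by auto
  qed simp
  then show "subadditive m d"
    unfolding subadditive_def subadditive_term_def by (metis atLeastAtMost_iff list.size(3) not_one_le_zero)
qed

section \<open>Increasing sequences, their counting functions and Wei duality\<close>

text \<open>The function \<open>N\<close> of the overview; for increasing weights it is the upper
  adjoint of \<open>d\<close>.\<close>

definition count_upto :: "nat \<Rightarrow> (nat \<Rightarrow> nat) \<Rightarrow> nat \<Rightarrow> nat" where
  "count_upto m d x = card {i \<in> {1..m}. d i \<le> x}"

locale increasing_weights =
  fixes m :: nat and d :: "nat \<Rightarrow> nat"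
  assumes weight_0: "d 0 = 0"
    and weight_strict: "i < j \<Longrightarrow> j \<le> m \<Longrightarrow> d i < d j"
begin

lemma weight_mono: "i \<le> j \<Longrightarrow> j \<le> m \<Longrightarrow> d i \<le> d j"
  using weight_strict[of i j] by (cases "i = j") auto

lemma weight_pos: "i \<in> {1..m} \<Longrightarrow> d i \<ge> 1"
  using weight_strict[of 0 i] by auto

lemma inj_on_weight: "inj_on d {1..m}"
  by (rule linorder_inj_onI') (metis atLeastAtMost_iff less_irrefl weight_strict)

lemma count_upto_le: "count_upto m d x \<le> m"
proof -
  have "count_upto m d x \<le> card {1..m}"
    unfolding count_upto_def by (intro card_mono) auto
  then show ?thesis by simp
qed

lemma count_upto_mono: "x \<le> y \<Longrightarrow> count_upto m d x \<le> count_upto m d y"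
  unfolding count_upto_def by (intro card_mono) auto

text \<open>As \<open>d\<close> increases, the counted indices form an initial segment. This Galois
  connection translates inequalities between weights into inequalities between counts.\<close>

lemma weight_le_iff:
  assumes "j \<le> m"
  shows "d j \<le> x \<longleftrightarrow> j \<le> count_upto m d x"
proof
  assume dj: "d j \<le> x"
  have "{1..j} \<subseteq> {i \<in> {1..m}. d i \<le> x}"
    using order_trans[OF weight_mono[OF _ assms] dj] assms by auto
  then have "card {1..j} \<le> count_upto m d x"
    unfolding count_upto_def by (intro card_mono) auto
  then show "j \<le> count_upto m d x" by simp
next
  assume le: "j \<le> count_upto m d x"
  show "d j \<le> x"
  proof (rule ccontr)
    assume "\<not> d j \<le> x"
    then have j: "j \<ge> 1" "x < d j" using weight_0 by (cases j; auto)+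
    have "{i \<in> {1..m}. d i \<le> x} \<subseteq> {1..<j}"
    proof
      fix i assume i: "i \<in> {i \<in> {1..m}. d i \<le> x}"
      have "i < j" using i j weight_mono[of j i] by (cases "i < j") auto
      then show "i \<in> {1..<j}" using i by simp
    qed
    then have "count_upto m d x \<le> card {1..<j}"
      unfolding count_upto_def by (intro card_mono) auto
    then show False using le j by simp
  qed
qed

lemma weight_count_upto: "d (count_upto m d x) \<le> x"
  using weight_le_iff[OF count_upto_le] by simp

lemma count_upto_weight: "j \<le> m \<Longrightarrow> count_upto m d (d j) \<ge> j"
  using weight_le_iff by blast

text \<open>By injectivity each value is taken at most once, so the jumps of the counting function
  mark the image of \<open>d\<close>; the Wei dual is identified through these jumps.\<close>

lemma count_upto_Suc:
  "count_upto m d (Suc x) = count_upto m d x + (if Suc x \<in> d ` {1..m} then 1 else 0)"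
proof (cases "Suc x \<in> d ` {1..m}")
  case True
  then obtain i where i: "i \<in> {1..m}" "d i = Suc x" by auto
  have "j = i" if "j \<in> {1..m}" "d j = Suc x" for j
    using that i inj_onD[OF inj_on_weight, of j i] by simp
  then have "{j \<in> {1..m}. d j = Suc x} = {i}" using i by blast
  moreover have "{j \<in> {1..m}. d j \<le> Suc x} =
      {j \<in> {1..m}. d j = Suc x} \<union> {j \<in> {1..m}. d j \<le> x}"
    by (auto simp: le_Suc_eq)
  ultimately have "{j \<in> {1..m}. d j \<le> Suc x} = insert i {j \<in> {1..m}. d j \<le> x}" by simp
  then show ?thesis using True i by (simp add: count_upto_def)
next
  case False
  then have "d j \<noteq> Suc x" if "j \<in> {1..m}" for j using that by (metis imageI)
  then have "{j \<in> {1..m}. d j \<le> Suc x} = {j \<in> {1..m}. d j \<le> x}"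
    by (intro Collect_cong conj_cong refl) (simp add: le_Suc_eq)
  then show ?thesis using False by (simp add: count_upto_def)
qed

text \<open>Zero parts are dropped, the part at which the running sum reaches \<open>s\<close> is
  shortened to fit, and later parts are discarded; monotonicity of \<open>d\<close> keeps the cost
  from rising.\<close>

lemma exact_decomposition:
  assumes "set as \<subseteq> {..m}" "s \<le> sum_list as"
  shows "\<exists>bs. set bs \<subseteq> {1..m} \<and> sum_list bs = s \<and> (\<Sum>b\<leftarrow>bs. d b) \<le> (\<Sum>a\<leftarrow>as. d a)"
  using assms
proof (induction as arbitrary: s)
  case Nil
  then show ?case by (intro exI[of _ "[]"]) simp
next
  case (Cons a as)
  show ?case
  proof (cases "s = 0 \<or> a = 0")
    case True
    then show ?thesis
    proof
      assume "s = 0"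
      then show ?thesis by (intro exI[of _ "[]"]) simp
    next
      assume "a = 0"
      then show ?thesis using Cons weight_0 by auto
    qed
  next
    case False
    show ?thesis
    proof (cases "s \<le> a")
      case True
      then have "d s \<le> d a" using Cons.prems by (intro weight_mono) auto
      then show ?thesis using True False Cons.prems by (intro exI[of _ "[s]"]) auto
    next
      case *: False
      have "\<exists>bs. set bs \<subseteq> {1..m} \<and> sum_list bs = s - a \<and> (\<Sum>b\<leftarrow>bs. d b) \<le> (\<Sum>a\<leftarrow>as. d a)"
        using Cons.prems by (intro Cons.IH) auto
      then obtain bs where "set bs \<subseteq> {1..m}" "sum_list bs = s - a"
          "(\<Sum>b\<leftarrow>bs. d b) \<le> (\<Sum>a\<leftarrow>as. d a)" by blast
      then show ?thesis using False * Cons.prems by (intro exI[of _ "a # bs"]) auto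
    qed
  qed
qed

text \<open>Extending \<open>d\<close> quasi-periodically by \<open>d (i + m) = d i + d m\<close>, the next condition is
  subadditivity of the extension across one period, as \<^const>\<open>subadditive\<close> is subadditivity
  within one period.\<close>

definition wrap_subadditive :: bool where
  "wrap_subadditive \<longleftrightarrow>
    (\<forall>a\<in>{1..m}. \<forall>b\<in>{1..m}. m < a + b \<longrightarrow> d m + d (a + b - m) \<le> d a + d b)"

text \<open>With \<open>a\<close> and \<open>b\<close> the counts at \<open>x\<close> and
  \<open>y\<close>, the adjunction reduces superadditivity of the counts to the inequality for two
  parts; conversely the counts are evaluated at \<open>x = d a\<close> and
  \<open>y = d b\<close>.\<close>

lemma subadditive_iff_count_upto:
  "subadditive m d \<longleftrightarrow>
    (\<forall>x y. x + y \<le> d m \<longrightarrow> count_upto m d x + count_upto m d y \<le> count_upto m d (x + y))"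
proof
  assume "subadditive m d"
  then have pairs: "d (a + b) \<le> d a + d b" if "a \<ge> 1" "b \<ge> 1" "a + b \<le> m" for a b
    using that subadditive_iff_pairs by blast
  show "\<forall>x y. x + y \<le> d m \<longrightarrow> count_upto m d x + count_upto m d y \<le> count_upto m d (x + y)"
  proof (intro allI impI)
    fix x y assume xy: "x + y \<le> d m"
    define a b where "a = count_upto m d x" and "b = count_upto m d y"
    have le: "d a \<le> x" "d b \<le> y" "a \<le> m" "b \<le> m"
      unfolding a_def b_def by (auto intro: weight_count_upto count_upto_le)
    have "a + b \<le> count_upto m d (x + y)"
    proof (cases "a = 0 \<or> b = 0")
      case True
      then show ?thesis
        using count_upto_mono[of x "x + y"] count_upto_mono[of y "x + y"] a_def b_def by auto
    next
      case False
      have "a + b \<le> m"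
      proof (rule ccontr)
        assume "\<not> a + b \<le> m"
        \<comment> \<open>The contradiction is
          \<open>d m \<le> d a + d (m - a) < d a + d b \<le> x + y \<le> d m\<close>.\<close>
        then have "d (m - a) < d b" using le False by (intro weight_strict) auto
        moreover have "d m \<le> d a + d (m - a)"
          using pairs[of a "m - a"] le False by (cases "a = m") auto
        ultimately show False using le xy by linarith
      qed
      moreover from this have "d (a + b) \<le> x + y"
        using pairs[of a b] False le by linarith
      ultimately show ?thesis using weight_le_iff by blast
    qed
    then show "count_upto m d x + count_upto m d y \<le> count_upto m d (x + y)"
      by (simp add: a_def b_def)
  qed
next
  assume N: "\<forall>x y. x + y \<le> d m \<longrightarrow> count_upto m d x + count_upto m d y \<le> count_upto m d (x + y)"
  show "subadditive m d"
    unfolding subadditive_iff_pairs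
  proof (intro allI impI)
    fix a b assume ab: "a \<ge> 1" "b \<ge> 1" "a + b \<le> m"
    show "d (a + b) \<le> d a + d b"
    proof (rule ccontr)
      assume neg: "\<not> d (a + b) \<le> d a + d b"
      then have "d a + d b \<le> d m" using weight_mono[OF ab(3)] by linarith
      then have "count_upto m d (d a) + count_upto m d (d b) \<le> count_upto m d (d a + d b)"
        using N by blast
      then have "a + b \<le> count_upto m d (d a + d b)"
        using count_upto_weight[of a] count_upto_weight[of b] ab by linarith
      then show False using neg weight_le_iff[OF ab(3)] by blast
    qed
  qed
qed

text \<open>If counts are extended to grow by \<open>m\<close> per period \<open>d m\<close>, the
  right-hand side is their superadditivity across the period boundary; the adjunction is applied as
  before.\<close>

lemma wrap_subadditive_iff_count_upto:
  "wrap_subadditive \<longleftrightarrow>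
    (\<forall>x y. x \<le> d m \<and> y \<le> d m \<and> d m \<le> x + y \<longrightarrow>
      count_upto m d x + count_upto m d y \<le> m + count_upto m d (x + y - d m))"
proof
  assume wrap: wrap_subadditive
  show "\<forall>x y. x \<le> d m \<and> y \<le> d m \<and> d m \<le> x + y \<longrightarrow>
      count_upto m d x + count_upto m d y \<le> m + count_upto m d (x + y - d m)"
  proof (intro allI impI)
    fix x y assume xy: "x \<le> d m \<and> y \<le> d m \<and> d m \<le> x + y"
    define a b where "a = count_upto m d x" and "b = count_upto m d y"
    have le: "d a \<le> x" "d b \<le> y" "a \<le> m" "b \<le> m"
      unfolding a_def b_def by (auto intro: weight_count_upto count_upto_le)
    have "a + b \<le> m + count_upto m d (x + y - d m)"
    proof (cases "a + b \<le> m")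
      case False
      then have "d m + d (a + b - m) \<le> d a + d b"
        using wrap le unfolding wrap_subadditive_def by auto
      then have "d (a + b - m) \<le> x + y - d m" using le by linarith
      then show ?thesis using weight_le_iff[of "a + b - m"] le by auto
    qed simp
    then show "count_upto m d x + count_upto m d y \<le> m + count_upto m d (x + y - d m)"
      by (simp add: a_def b_def)
  qed
next
  assume N: "\<forall>x y. x \<le> d m \<and> y \<le> d m \<and> d m \<le> x + y \<longrightarrow>
      count_upto m d x + count_upto m d y \<le> m + count_upto m d (x + y - d m)"
  show wrap_subadditive
    unfolding wrap_subadditive_def
  proof (intro ballI impI)
    fix a b assume ab: "a \<in> {1..m}" "b \<in> {1..m}" "m < a + b"
    have le: "d a \<le> d m" "d b \<le> d m" using ab weight_mono by auto
    have ca: "a \<le> count_upto m d (d a)" and cb: "b \<le> count_upto m d (d b)"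
      using ab count_upto_weight by auto
    \<comment> \<open>This rules out truncation in \<open>d a + d b - d m\<close>: otherwise
      \<open>d b \<le> d m - d a\<close>, and the hypothesis at \<open>d a\<close> and
      \<open>d m - d a\<close> would force \<open>a + b \<le> m\<close>.\<close>
    have ge: "d m \<le> d a + d b"
    proof (rule ccontr)
      assume neg: "\<not> d m \<le> d a + d b"
      then have "count_upto m d (d a) + count_upto m d (d m - d a) \<le> m + count_upto m d 0"
        using N[rule_format, of "d a" "d m - d a"] le by simp
      moreover have "count_upto m d 0 = 0"
        using weight_pos by (force simp: count_upto_def)
      moreover have "count_upto m d (d b) \<le> count_upto m d (d m - d a)"
        using neg by (intro count_upto_mono) simp
      ultimately show False using ca cb ab by linarith
    qed
    then have "count_upto m d (d a) + count_upto m d (d b) \<le> m + count_upto m d (d a + d b - d m)"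
      using N le by blast
    then have "a + b - m \<le> count_upto m d (d a + d b - d m)" using ca cb by linarith
    then show "d m + d (a + b - m) \<le> d a + d b"
      using weight_le_iff[of "a + b - m" "d a + d b - d m"] ab ge
      by (metis (no_types, lifting) add_le_mono atLeastAtMost_iff le_diff_conv le_diff_conv2 add.commute)
  qed
qed

text \<open>Adding a part \<open>a\<close> to a sum with remainder \<open>r\<close> either stays
  within the period, where subadditivity applies, or passes its end, where
  \<open>wrap_subadditive\<close> does.\<close>

lemma periodic_lower_bound:
  assumes "subadditive m d" wrap_subadditive "set as \<subseteq> {1..m}"
  shows "sum_list as div m * d m + d (sum_list as mod m) \<le> (\<Sum>a\<leftarrow>as. d a)"
  using assms(3)
proof (induction as)
  case (Cons a as)
  define q r where "q = sum_list as div m" and "r = sum_list as mod m"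
  have a: "1 \<le> a" "a \<le> m" using Cons.prems by auto
  have s: "sum_list as = q * m + r" and r: "r < m" using a by (auto simp: q_def r_def)
  have sub: "d (x + y) \<le> d x + d y" if "x \<ge> 1" "y \<ge> 1" "x + y \<le> m" for x y
    using assms(1) that subadditive_iff_pairs by blast
  have IH: "q * d m + d r \<le> (\<Sum>a\<leftarrow>as. d a)"
    using Cons by (simp add: q_def r_def)
  have "(a + sum_list as) div m * d m + d ((a + sum_list as) mod m) \<le> q * d m + d r + d a"
  proof (cases "a + r < m")
    case True
    have eq: "a + sum_list as = (a + r) + q * m" using s by simp
    have "(a + sum_list as) div m = q" "(a + sum_list as) mod m = a + r"
      unfolding eq using True by simp_all
    moreover have "d (a + r) \<le> d a + d r"
      using sub[of a r] a True by (cases "r = 0") auto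
    ultimately show ?thesis by simp
  next
    case False
    have eq: "a + sum_list as = (a + r - m) + Suc q * m" using s False by simp
    have lt: "a + r - m < m" using a r by linarith
    have "(a + sum_list as) div m = Suc q" "(a + sum_list as) mod m = a + r - m"
      unfolding eq using lt by (simp_all del: mult_Suc)
    moreover have "d m + d (a + r - m) \<le> d a + d r"
    \<comment> \<open>Landing exactly on the boundary leaves remainder 0; plain subadditivity and
      \<open>d 0 = 0\<close> cover this.\<close>
    proof (cases "a + r = m")
      case True
      then show ?thesis using sub[of a r] a weight_0 by (cases "r = 0") auto
    next
      case *: False
      then have "r \<ge> 1" using False a by linarith
      then show ?thesis using assms(2) * False a r unfolding wrap_subadditive_def by auto
    qed
    ultimately show ?thesis by simp
  qed
  then show ?case using IH by simp
qed (simp add: weight_0)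

text \<open>Two-part decompositions yield the first condition from \<open>q = 0\<close> and the
  second from \<open>q = 1\<close>. Conversely, \<open>q\<close> copies of \<open>m\<close> together
  with \<open>r\<close> attain the bound of \<open>periodic_lower_bound\<close>.\<close>

lemma periodic_min_cost_iff:
  assumes "m \<ge> 1"
  shows "(\<forall>q. \<forall>r\<in>{1..m}. min_cost m d (m * q + r) = q * d m + d r) \<longleftrightarrow>
    subadditive m d \<and> wrap_subadditive"
proof
  assume per: "\<forall>q. \<forall>r\<in>{1..m}. min_cost m d (m * q + r) = q * d m + d r"
  have pair: "min_cost m d (a + b) \<le> d a + d b" if "a \<in> {1..m}" "b \<in> {1..m}" for a b
    using min_cost_le[of "[a, b]" m d] that by simp
  have "d (a + b) \<le> d a + d b" if "a \<ge> 1" "b \<ge> 1" "a + b \<le> m" for a b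
    using per[rule_format, of "a + b" 0] pair[of a b] that by simp
  then have "subadditive m d" by (simp add: subadditive_iff_pairs)
  moreover have wrap_subadditive
    unfolding wrap_subadditive_def
  proof (intro ballI impI)
    fix a b assume ab: "a \<in> {1..m}" "b \<in> {1..m}" "m < a + b"
    then have "a + b - m \<in> {1..m}" by auto
    then show "d m + d (a + b - m) \<le> d a + d b"
      using per[rule_format, of "a + b - m" 1] pair[OF ab(1,2)] ab(3) by simp
  qed
  ultimately show "subadditive m d \<and> wrap_subadditive" ..
next
  assume sub: "subadditive m d \<and> wrap_subadditive"
  show "\<forall>q. \<forall>r\<in>{1..m}. min_cost m d (m * q + r) = q * d m + d r"
  proof (intro allI ballI)
    fix q r assume r: "r \<in> {1..m}"
    obtain as where as: "set as \<subseteq> {1..m}" "sum_list as = m * q + r"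
        "(\<Sum>a\<leftarrow>as. d a) = min_cost m d (m * q + r)"
      using min_cost_attained[OF assms] by blast
    \<comment> \<open>Here \<open>r\<close> runs over \<open>{1..m}\<close> while remainders lie
      below \<open>m\<close>: for \<open>r = m\<close> a whole period moves into the quotient and
      \<open>d 0 = 0\<close>.\<close>
    have "q * d m + d r = (m * q + r) div m * d m + d ((m * q + r) mod m)"
      using r weight_0 by (cases "r = m") auto
    also have "\<dots> \<le> min_cost m d (m * q + r)"
      using periodic_lower_bound[of as] sub as by simp
    finally have "q * d m + d r \<le> min_cost m d (m * q + r)" .
    moreover have "min_cost m d (m * q + r) \<le> q * d m + d r"
      using min_cost_le[of "replicate q m @ [r]" m d] r assms
      by (simp add: sum_list_replicate mult.commute set_replicate_conv_if)
    ultimately show "min_cost m d (m * q + r) = q * d m + d r" by simp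
  qed
qed

text \<open>\<open>m\<close> copies of \<open>i\<close> make exactly \<open>i\<close> periods, so
  the periodic bound reads \<open>i * d m \<le> m * d i\<close>.\<close>

lemma periodic_min_ratio:
  assumes "m \<ge> 1" "subadditive m d" wrap_subadditive
  shows "(MIN i\<in>{1..m}. real (d i) / real i) = real (d m) / real m"
proof (rule Min_eqI)
  fix y assume "y \<in> (\<lambda>i. real (d i) / real i) ` {1..m}"
  then obtain i where i: "i \<in> {1..m}" "y = real (d i) / real i" by blast
  have "sum_list (replicate m i) div m * d m + d (sum_list (replicate m i) mod m) \<le>
      (\<Sum>a\<leftarrow>replicate m i. d a)"
    by (rule periodic_lower_bound[OF assms(2,3)]) (use i in auto)
  then have "i * d m \<le> m * d i"
    using assms(1) weight_0 by (simp add: sum_list_replicate)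
  then have "real i * real (d m) \<le> real m * real (d i)"
    by (metis of_nat_le_iff of_nat_mult)
  then show "real (d m) / real m \<le> y"
    unfolding i(2) using i(1) assms(1) by (simp add: field_simps)
qed (use assms(1) in auto)

end

text \<open>Duality enters only through the counting identity, which keeps the argument free of
  matroids and allows the two sequences to be taken in either order.\<close>

locale wei_dual_weights =
  W: increasing_weights m d + W': increasing_weights m' d' for m m' d d' +
  fixes n :: nat
  assumes length_sum: "m + m' = n"
    and weight_le: "j \<le> m \<Longrightarrow> d j \<le> n" "j \<le> m' \<Longrightarrow> d' j \<le> n"
    and count_upto_dual: "x \<le> n \<Longrightarrow> count_upto m' d' x + m = x + count_upto m d (n - x)"
begin

text \<open>Comparing the counting identity at \<open>v - 1\<close> and at \<open>v\<close> shows
  that the dual count jumps at \<open>v\<close> exactly when the original count does not jump at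
  \<open>n + 1 - v\<close>.\<close>

lemma dual_image: "{1..n} - {n + 1 - d j | j. j \<in> {1..m}} = d' ` {1..m'}"
proof -
  have iff: "v \<in> d' ` {1..m'} \<longleftrightarrow> n + 1 - v \<notin> d ` {1..m}" if v: "v \<in> {1..n}" for v
  proof -
    obtain x where x: "v = Suc x" using v by (cases v) auto
    have Suc: "n - x = Suc (n - v)" using v x by simp
    have "count_upto m' d' v + m = Suc x + count_upto m d (n - v)"
      "count_upto m' d' x + m = x + count_upto m d (n - x)"
      using v x count_upto_dual[of v] count_upto_dual[of x] by auto
    moreover have "count_upto m' d' v =
        count_upto m' d' x + (if v \<in> d' ` {1..m'} then 1 else 0)"
      unfolding x by (rule W'.count_upto_Suc)
    moreover have "count_upto m d (n - x) =
        count_upto m d (n - v) + (if n - x \<in> d ` {1..m} then 1 else 0)"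
      unfolding Suc by (rule W.count_upto_Suc)
    moreover have "n + 1 - v = n - x" using x by simp
    ultimately show ?thesis
      by (cases "v \<in> d' ` {1..m'}"; cases "n - x \<in> d ` {1..m}"; simp del: image_iff)
  qed
  show ?thesis
  proof (intro subset_antisym subsetI)
    fix v assume v: "v \<in> {1..n} - {n + 1 - d j | j. j \<in> {1..m}}"
    have "n + 1 - v \<notin> d ` {1..m}"
    proof
      assume "n + 1 - v \<in> d ` {1..m}"
      then obtain j where j: "j \<in> {1..m}" "n + 1 - v = d j" by blast
      then have "v = n + 1 - d j" using v by auto
      then show False using v j by blast
    qed
    then show "v \<in> d' ` {1..m'}" using iff v by blast
  next
    fix v assume v: "v \<in> d' ` {1..m'}"
    then have v1: "v \<in> {1..n}" using W'.weight_pos weight_le(2) by auto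
    have "v \<noteq> n + 1 - d j" if "j \<in> {1..m}" for j
    proof
      assume "v = n + 1 - d j"
      then have "n + 1 - v = d j" using weight_le(1)[of j] that by auto
      then show False using iff[OF v1] v that by auto
    qed
    then show "v \<in> {1..n} - {n + 1 - d j | j. j \<in> {1..m}}" using v1 by blast
  qed
qed

lemma wei_dual_eq:
  assumes "i \<in> {1..m'}"
  shows "wei_dual n m d i = d' i"
proof -
  let ?xs = "map d' [1..<Suc m']"
  have "sorted_wrt (<) ?xs"
    unfolding sorted_wrt_map
    by (rule sorted_wrt_mono_rel[OF _ sorted_wrt_upt]) (auto intro: W'.weight_strict)
  then have "sorted ?xs" "distinct ?xs" by (simp_all add: strict_sorted_iff del: upt_Suc)
  then have "sorted_list_of_set (set ?xs) = ?xs"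
    by (rule sorted_list_of_set.idem_if_sorted_distinct)
  moreover have "set ?xs = d' ` {1..m'}"
    by (auto simp del: upt_Suc)
  ultimately have "sorted_list_of_set (d' ` {1..m'}) = ?xs" by simp
  moreover have "?xs ! (i - 1) = d' (1 + (i - 1))"
    by (rule nth_map_upt) (use assms in auto)
  ultimately show ?thesis
    unfolding wei_dual_def dual_image using assms by simp
qed

text \<open>Under \<open>count_upto_dual\<close>, replacing \<open>x\<close> and \<open>y\<close> by
  \<open>n - x\<close> and \<open>n - y\<close> turns superadditivity of the dual counts into the
  counting form of \<open>wrap_subadditive\<close>. Top weights equal to \<open>n\<close> make the
  two ranges correspond.\<close>

lemma subadditive_dual_iff_wrap:
  assumes "d m = n" "d' m' = n"
  shows "subadditive m' d' \<longleftrightarrow> W.wrap_subadditive"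
proof -
  let ?N = "count_upto m d" and ?N' = "count_upto m' d'"
  have "subadditive m' d' \<longleftrightarrow> (\<forall>x y. x + y \<le> n \<longrightarrow> ?N' x + ?N' y \<le> ?N' (x + y))"
    using W'.subadditive_iff_count_upto assms by simp
  also have "\<dots> \<longleftrightarrow> (\<forall>x y. x \<le> n \<and> y \<le> n \<and> n \<le> x + y \<longrightarrow> ?N x + ?N y \<le> m + ?N (x + y - n))"
  proof (intro iffI allI impI)
    fix x y assume N': "\<forall>x y. x + y \<le> n \<longrightarrow> ?N' x + ?N' y \<le> ?N' (x + y)"
      and xy: "x \<le> n \<and> y \<le> n \<and> n \<le> x + y"
    define x' y' where "x' = n - x" and "y' = n - y"
    then have x'y': "x' + y' \<le> n" "x = n - x'" "y = n - y'" "x + y - n = n - (x' + y')"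
      using xy by auto
    have "?N' x' + ?N' y' \<le> ?N' (x' + y')" using N' x'y'(1) by blast
    then show "?N x + ?N y \<le> m + ?N (x + y - n)"
      using count_upto_dual[of x'] count_upto_dual[of y'] count_upto_dual[of "x' + y'"] x'y'(1)
      unfolding x'y'(4) unfolding x'y'(2,3) by linarith
  next
    fix x y assume N: "\<forall>x y. x \<le> n \<and> y \<le> n \<and> n \<le> x + y \<longrightarrow> ?N x + ?N y \<le> m + ?N (x + y - n)"
      and xy: "x + y \<le> n"
    have "n - x \<le> n \<and> n - y \<le> n \<and> n \<le> (n - x) + (n - y)" using xy by linarith
    then have "?N (n - x) + ?N (n - y) \<le> m + ?N ((n - x) + (n - y) - n)" using N by blast
    moreover have "(n - x) + (n - y) - n = n - (x + y)" using xy by simp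
    ultimately show "?N' x + ?N' y \<le> ?N' (x + y)"
      using count_upto_dual[of x] count_upto_dual[of y] count_upto_dual[of "x + y"] xy by auto
  qed
  also have "\<dots> \<longleftrightarrow> W.wrap_subadditive"
    using W.wrap_subadditive_iff_count_upto assms by simp
  finally show ?thesis .
qed

lemma cosubadditive_iff: "cosubadditive n m d \<longleftrightarrow> subadditive m' d'"
proof -
  have "n - m = m'" using length_sum by simp
  moreover have "subadditive m' (wei_dual n m d) \<longleftrightarrow> subadditive m' d'"
    unfolding subadditive_iff_pairs by (auto simp: wei_dual_eq)
  ultimately show ?thesis unfolding cosubadditive_def by simp
qed

end

section \<open>Monomials in ideals\<close>

text \<open>For finite \<open>B\<close>, the order of the monomial with exponent \<open>x\<close>
  along the prime \<open>P_B\<close>.\<close>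

definition weight_on :: "'e set \<Rightarrow> ('e \<Rightarrow>\<^sub>0 nat) \<Rightarrow> nat" where
  "weight_on B x = (\<Sum>e\<in>B. Poly_Mapping.lookup x e)"

abbreviation monom :: "('e \<Rightarrow>\<^sub>0 nat) \<Rightarrow> ('e, 'l::field) mpoly" where
  "monom x \<equiv> Poly_Mapping.single x 1"

lemma weight_on_0 [simp]: "weight_on B 0 = 0"
  by (simp add: weight_on_def)

lemma weight_on_add [simp]: "weight_on B (x + y) = weight_on B x + weight_on B y"
  by (simp add: weight_on_def lookup_add sum.distrib)

lemma weight_on_single:
  "finite B \<Longrightarrow> weight_on B (Poly_Mapping.single e c) = (if e \<in> B then c else 0)"
  by (simp add: weight_on_def lookup_single when_def)

lemma monomial_deg_eq_weight_on:
  "finite E \<Longrightarrow> Poly_Mapping.keys x \<subseteq> E \<Longrightarrow> monomial_deg x = weight_on E x"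
  unfolding monomial_deg_def weight_on_def
  by (rule sum.mono_neutral_left) (auto simp: in_keys_iff)

lemma homogeneous_monom: "homogeneous (monomial_deg x) (monom x)"
  by (simp add: homogeneous_def)

section \<open>Monomial conditions and powers of the variable ideals\<close>

lemma mpoly_ring_simps [simp]:
  "p \<in> carrier (mpoly_ring E) \<longleftrightarrow> (\<forall>x\<in>Poly_Mapping.keys p. Poly_Mapping.keys x \<subseteq> E)"
  "p \<otimes>\<^bsub>mpoly_ring E\<^esub> q = p * q"
  "p \<oplus>\<^bsub>mpoly_ring E\<^esub> q = p + q"
  "\<one>\<^bsub>mpoly_ring E\<^esub> = 1"
  "\<zero>\<^bsub>mpoly_ring E\<^esub> = 0"
  by (simp_all add: mpoly_ring_def)

lemma ring_mpoly_ring: "ring (mpoly_ring E :: ('e, 'l::field) mpoly ring)"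
  by (rule cring.axioms(1)[OF cring_mpoly_ring])

text \<open>Every exponent of a product is a sum of exponents of the factors, so a condition stable
  under adding exponents survives multiplication by ring elements.\<close>

lemma ideal_of_monomial_condition:
  assumes "\<And>x y. P x \<Longrightarrow> P (x + y)"
  shows "ideal {p. \<forall>x\<in>Poly_Mapping.keys p. Poly_Mapping.keys x \<subseteq> E \<and> P x}
    (mpoly_ring E :: ('e, 'l::field) mpoly ring)" (is "ideal ?I ?S")
proof (rule idealI)
  interpret cring ?S by (rule cring_mpoly_ring)
  show "ring ?S" by (rule ring_mpoly_ring)
  have neg: "\<ominus>\<^bsub>?S\<^esub> p = - p" if "p \<in> carrier ?S" for p
    by (rule minus_equality) (use that in auto)
  show "subgroup ?I (add_monoid ?S)"
  proof (rule group.subgroupI)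
    show "Group.group (add_monoid ?S)" by (rule a_group)
    show "?I \<noteq> {}" by (auto intro: exI[of _ 0])
    show "?I \<subseteq> carrier (add_monoid ?S)" by auto
  next
    fix p assume p: "p \<in> ?I"
    then have "inv\<^bsub>add_monoid ?S\<^esub> p = - p" using neg[of p] unfolding a_inv_def by auto
    then show "inv\<^bsub>add_monoid ?S\<^esub> p \<in> ?I" using p by simp
  next
    fix p q assume "p \<in> ?I" "q \<in> ?I"
    then show "p \<otimes>\<^bsub>add_monoid ?S\<^esub> q \<in> ?I" using Poly_Mapping.keys_add[of p q] by auto
  qed
  show closed: "q \<otimes>\<^bsub>?S\<^esub> p \<in> ?I" if p: "p \<in> ?I" and q: "q \<in> carrier ?S" for p q
  proof -
    have "Poly_Mapping.keys x \<subseteq> E \<and> P x" if x: "x \<in> Poly_Mapping.keys (q * p)" for x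
    proof -
      obtain a b where ab: "x = a + b" "a \<in> Poly_Mapping.keys q" "b \<in> Poly_Mapping.keys p"
        using x keys_mult[of q p] by blast
      have "Poly_Mapping.keys a \<subseteq> E" "Poly_Mapping.keys b \<subseteq> E" "P b" using ab p q by auto
      then show ?thesis
        using Poly_Mapping.keys_add[of a b] assms[of b a] ab(1) by (auto simp: add.commute)
    qed
    then show ?thesis by auto
  qed
  show "p \<otimes>\<^bsub>?S\<^esub> q \<in> ?I" if "p \<in> ?I" "q \<in> carrier ?S" for p q
    using closed[OF that] by (simp add: mult.commute)
qed

lemma genideal_subset_monomial_condition:
  fixes G :: "('e, 'l::field) mpoly set"
  assumes "\<And>x y. P x \<Longrightarrow> P (x + y)"
    and "\<And>p x. p \<in> G \<Longrightarrow> x \<in> Poly_Mapping.keys p \<Longrightarrow> Poly_Mapping.keys x \<subseteq> E \<and> P x"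
    and "p \<in> genideal (mpoly_ring E) G" "x \<in> Poly_Mapping.keys p"
  shows "P x"
proof -
  interpret ring "mpoly_ring E :: ('e, 'l) mpoly ring" by (rule ring_mpoly_ring)
  have "genideal (mpoly_ring E) G \<subseteq>
      {p. \<forall>x\<in>Poly_Mapping.keys p. Poly_Mapping.keys x \<subseteq> E \<and> P x}" (is "_ \<subseteq> ?I")
  proof (rule genideal_minimal)
    show "ideal ?I (mpoly_ring E)"
      by (rule ideal_of_monomial_condition) (rule assms(1))
    show "G \<subseteq> ?I" using assms(2) by blast
  qed
  then show ?thesis using assms(3,4) by blast
qed

lemma mvar_image_carrier: "B \<subseteq> E \<Longrightarrow> mvar ` B \<subseteq> carrier (mpoly_ring E)"
  by (auto simp: mvar_def)

lemma ideals_set_pow_0: "I [^]\<^bsub>ideals_set S\<^esub> (0::nat) = carrier S"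
  by (simp add: nat_pow_def ideals_set_def)

lemma ideals_set_pow_Suc:
  "I [^]\<^bsub>ideals_set S\<^esub> Suc s = ideal_prod S (I [^]\<^bsub>ideals_set S\<^esub> s) I"
  by (simp add: nat_pow_def ideals_set_def)

text \<open>Outer induction on \<open>s\<close>, inner induction on the generation of the ideal
  product: the factor from the first power adds at least one to the weight on \<open>B\<close>, and
  sums create no new exponents.\<close>

lemma weight_on_ideal_power:
  fixes p :: "('e, 'l::field) mpoly"
  assumes "B \<subseteq> E" "finite E"
    and "p \<in> genideal (mpoly_ring E) (mvar ` B) [^]\<^bsub>ideals_set (mpoly_ring E)\<^esub> s"
    and "x \<in> Poly_Mapping.keys p"
  shows "Poly_Mapping.keys x \<subseteq> E \<and> s \<le> weight_on B x"
  using assms(3,4)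
proof (induction s arbitrary: p x)
  case 0
  then show ?case unfolding ideals_set_pow_0 by simp
next
  case (Suc s)
  interpret ring "mpoly_ring E :: ('e, 'l) mpoly ring" by (rule ring_mpoly_ring)
  have fB: "finite B" using assms(1,2) finite_subset by blast
  have "p \<in> ideal_prod (mpoly_ring E)
      (genideal (mpoly_ring E) (mvar ` B) [^]\<^bsub>ideals_set (mpoly_ring E)\<^esub> s)
      (genideal (mpoly_ring E) (mvar ` B))"
    using Suc.prems(1) unfolding ideals_set_pow_Suc .
  then show ?case
    using Suc.prems(2)
  proof (induction p arbitrary: x rule: ideal_prod.induct)
    case (prod i j)
    then obtain a b where ab: "x = a + b" "a \<in> Poly_Mapping.keys i" "b \<in> Poly_Mapping.keys j"
      using keys_mult[of i j] by auto
    have a: "Poly_Mapping.keys a \<subseteq> E \<and> s \<le> weight_on B a"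
      using Suc.IH[OF prod.hyps(1) ab(2)] .
    have "j \<in> carrier (mpoly_ring E)"
      using ideal.Icarr[OF genideal_ideal[OF mvar_image_carrier[OF assms(1)]] prod.hyps(2)] .
    then have b: "Poly_Mapping.keys b \<subseteq> E" using ab(3) by simp
    have "1 \<le> weight_on B b"
    proof (rule genideal_subset_monomial_condition[OF _ _ prod.hyps(2) ab(3)])
      fix q :: "('e, 'l) mpoly" and y
      assume "q \<in> mvar ` B" "y \<in> Poly_Mapping.keys q"
      then obtain e where "e \<in> B" "y = Poly_Mapping.single e 1" by (auto simp: mvar_def)
      then show "Poly_Mapping.keys y \<subseteq> E \<and> 1 \<le> weight_on B y"
        using assms(1) fB by (auto simp: weight_on_single)
    qed simp
    then show ?case using a b ab(1) Poly_Mapping.keys_add[of a b] by auto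
  next
    case (sum p1 p2)
    then show ?case using Poly_Mapping.keys_add[of p1 p2] by auto
  qed
qed

text \<open>Positive weight on \<open>B\<close> exposes a variable of \<open>B\<close> dividing the
  monomial; splitting it off lowers \<open>s\<close> by one.\<close>

lemma monom_in_ideal_power:
  fixes x :: "'e \<Rightarrow>\<^sub>0 nat"
  assumes "B \<subseteq> E" "finite E" "Poly_Mapping.keys x \<subseteq> E" "s \<le> weight_on B x"
  shows "(monom x :: ('e, 'l::field) mpoly) \<in>
    genideal (mpoly_ring E) (mvar ` B) [^]\<^bsub>ideals_set (mpoly_ring E)\<^esub> s"
  using assms(3,4)
proof (induction s arbitrary: x)
  case 0
  then show ?case unfolding ideals_set_pow_0 by simp
next
  case (Suc s)
  interpret ring "mpoly_ring E :: ('e, 'l) mpoly ring" by (rule ring_mpoly_ring)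
  have fB: "finite B" using assms(1,2) finite_subset by blast
  have "weight_on B x \<noteq> 0" using Suc.prems(2) by simp
  then obtain e where e: "e \<in> B" "Poly_Mapping.lookup x e \<noteq> 0"
    unfolding weight_on_def by (meson sum.neutral)
  define y where "y = x - Poly_Mapping.single e 1"
  have x: "x = y + Poly_Mapping.single e 1"
    using e(2) by (intro poly_mapping_eqI)
      (auto simp: y_def lookup_add lookup_minus lookup_single when_def)
  have "Poly_Mapping.keys y \<subseteq> E"
    using Suc.prems(1) by (auto simp: y_def in_keys_iff lookup_minus)
  moreover have "s \<le> weight_on B y"
    using Suc.prems(2) e(1) fB by (simp add: x weight_on_single)
  ultimately have "(monom y :: ('e, 'l) mpoly) \<in>
      genideal (mpoly_ring E) (mvar ` B) [^]\<^bsub>ideals_set (mpoly_ring E)\<^esub> s"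
    by (rule Suc.IH)
  moreover have "(mvar e :: ('e, 'l) mpoly) \<in> genideal (mpoly_ring E) (mvar ` B)"
    using genideal_self[OF mvar_image_carrier[OF assms(1)]] e(1) by blast
  ultimately have "(monom y * mvar e :: ('e, 'l) mpoly) \<in>
      genideal (mpoly_ring E) (mvar ` B) [^]\<^bsub>ideals_set (mpoly_ring E)\<^esub> Suc s"
    using ideal_prod.prod[of "monom y" _ "mvar e" _ "mpoly_ring E"]
    unfolding ideals_set_pow_Suc by simp
  moreover have "(monom y * mvar e :: ('e, 'l) mpoly) = monom x"
    by (simp add: mvar_def mult_single x)
  ultimately show ?case by simp
qed

section \<open>Initial degrees, squarefree monomials and level sets\<close>

lemma alpha_eqI:
  assumes "p \<in> I" "p \<noteq> 0" "homogeneous t p"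
    and "\<And>q x. q \<in> I \<Longrightarrow> x \<in> Poly_Mapping.keys q \<Longrightarrow> t \<le> monomial_deg x"
  shows "alpha I = t"
  unfolding alpha_def
proof (rule Least_equality)
  show "\<exists>p\<in>I. p \<noteq> 0 \<and> homogeneous t p" using assms(1-3) by blast
next
  fix t' assume "\<exists>q\<in>I. q \<noteq> 0 \<and> homogeneous t' q"
  then obtain q where q: "q \<in> I" "q \<noteq> 0" "homogeneous t' q" by blast
  then obtain x where "x \<in> Poly_Mapping.keys q" by (metis all_not_in_conv keys_eq_empty)
  then show "t \<le> t'" using assms(4)[OF q(1)] q(3) by (auto simp: homogeneous_def)
qed

definition indicator_exponent :: "'e set \<Rightarrow> 'e \<Rightarrow>\<^sub>0 nat" where
  "indicator_exponent U = (\<Sum>e\<in>U. Poly_Mapping.single e 1)"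

lemma lookup_indicator_exponent:
  "finite U \<Longrightarrow> Poly_Mapping.lookup (indicator_exponent U) e = (if e \<in> U then 1 else 0)"
  by (simp add: indicator_exponent_def lookup_sum lookup_single when_def)

lemma keys_indicator_exponent: "finite U \<Longrightarrow> Poly_Mapping.keys (indicator_exponent U) = U"
  by (auto simp: in_keys_iff lookup_indicator_exponent split: if_splits)

lemma weight_on_indicator_exponent:
  "finite U \<Longrightarrow> finite B \<Longrightarrow> weight_on B (indicator_exponent U) = card (B \<inter> U)"
  by (simp add: weight_on_def lookup_indicator_exponent sum.If_cases Int_def)

lemma monomial_deg_indicator_exponent: "finite U \<Longrightarrow> monomial_deg (indicator_exponent U) = card U"
  using monomial_deg_eq_weight_on[of U "indicator_exponent U"]
  by (simp add: keys_indicator_exponent weight_on_indicator_exponent)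

lemma prod_mvar: "finite C \<Longrightarrow> (\<Prod>e\<in>C. mvar e) = monom (indicator_exponent C)"
  by (induction C rule: finite_induct) (auto simp: indicator_exponent_def mvar_def mult_single)

lemma card_le_monomial_deg:
  assumes "C \<subseteq> Poly_Mapping.keys x"
  shows "card C \<le> monomial_deg x"
proof -
  have "card C \<le> card (Poly_Mapping.keys x)" using assms by (intro card_mono) auto
  also have "\<dots> = (\<Sum>e\<in>Poly_Mapping.keys x. 1)" by simp
  also have "\<dots> \<le> monomial_deg x"
    unfolding monomial_deg_def by (intro sum_mono) (auto simp: in_keys_iff)
  finally show ?thesis .
qed

text \<open>An exponent equals the number of thresholds \<open>t \<ge> 1\<close> that it reaches;
  exchanging the summations yields the sizes of the level sets.\<close>

lemma weight_on_level_sets: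
  assumes "finite B" "\<And>e. e \<in> B \<Longrightarrow> Poly_Mapping.lookup x e \<le> N"
  shows "weight_on B x = (\<Sum>t=1..N. card (B \<inter> {e. t \<le> Poly_Mapping.lookup x e}))"
proof -
  have "Poly_Mapping.lookup x e = (\<Sum>t=1..N. if t \<le> Poly_Mapping.lookup x e then 1 else 0)"
    if "e \<in> B" for e
  proof -
    have "{1..N} \<inter> {t. t \<le> Poly_Mapping.lookup x e} = {1..Poly_Mapping.lookup x e}"
      using assms(2)[OF that] by auto
    then show ?thesis by (simp add: sum.If_cases)
  qed
  then have "weight_on B x = (\<Sum>e\<in>B. \<Sum>t=1..N. if t \<le> Poly_Mapping.lookup x e then 1 else 0)"
    unfolding weight_on_def by (intro sum.cong) auto
  also have "\<dots> = (\<Sum>t=1..N. \<Sum>e\<in>B. if t \<le> Poly_Mapping.lookup x e then 1 else 0)"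
    by (rule sum.swap)
  also have "\<dots> = (\<Sum>t=1..N. card (B \<inter> {e. t \<le> Poly_Mapping.lookup x e}))"
    using assms(1) by (intro sum.cong) (simp_all add: sum.If_cases)
  finally show ?thesis .
qed

section \<open>Initial degrees of symbolic powers\<close>

context matroid
begin

lemma increasing_weights_ghw: "increasing_weights (nullity M (ground M)) (ghw M)"
  by unfold_locales (auto intro: ghw_less)

text \<open>The witness is the sum of the indicator vectors of smallest sets of nullity
  \<open>a\<close>, one for each part. Each adds \<open>ghw M a\<close> to the degree and, by
  \<open>nullity_le_card_base_dual\<close>, at least \<open>a\<close> to the weight on every basis
  of the dual.\<close>

lemma exponent_of_decomposition:
  assumes "set as \<subseteq> {1..nullity M (ground M)}"
  shows "\<exists>x. Poly_Mapping.keys x \<subseteq> ground M \<and> weight_on (ground M) x = (\<Sum>a\<leftarrow>as. ghw M a) \<and>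
    (\<forall>B\<in>bases (dual M). sum_list as \<le> weight_on B x)"
  using assms
proof (induction as)
  case Nil
  then show ?case by (intro exI[of _ 0]) simp
next
  case (Cons a as)
  then obtain x where x: "Poly_Mapping.keys x \<subseteq> ground M"
      "weight_on (ground M) x = (\<Sum>a\<leftarrow>as. ghw M a)"
      "\<And>B. B \<in> bases (dual M) \<Longrightarrow> sum_list as \<le> weight_on B x" by auto
  obtain U where U: "U \<subseteq> ground M" "nullity M U = a" "card U = ghw M a"
    using ghw_attained[of a] Cons.prems by auto
  have fU: "finite U" using U(1) finite_subset_ground by blast
  have "Poly_Mapping.keys (indicator_exponent U + x) \<subseteq> ground M"
    using Poly_Mapping.keys_add[of "indicator_exponent U" x] keys_indicator_exponent[OF fU] U x by blast
  moreover have "weight_on (ground M) (indicator_exponent U + x) = (\<Sum>a\<leftarrow>a # as. ghw M a)"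
    using U x fU finite_ground by (simp add: weight_on_indicator_exponent Int_absorb1)
  moreover have "sum_list (a # as) \<le> weight_on B (indicator_exponent U + x)"
    if B: "B \<in> bases (dual M)" for B
  proof -
    have "finite B" using B finite_ground by (auto simp: bases_dual)
    then have "weight_on B (indicator_exponent U) = card (B \<inter> U)"
      using fU by (intro weight_on_indicator_exponent)
    then show ?thesis
      using nullity_le_card_base_dual[OF B U(1)] U(2) x(3)[OF B] by simp
  qed
  ultimately show ?case by blast
qed

text \<open>The level sets of an exponent vector form a chain, so a single basis of the dual attains
  the nullity of all of them; its constraint alone gives the lower bound.\<close>

lemma min_cost_le_weight_on:
  assumes "Poly_Mapping.keys x \<subseteq> ground M"
    and "\<And>B. B \<in> bases (dual M) \<Longrightarrow> s \<le> weight_on B x"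
  shows "min_cost (nullity M (ground M)) (ghw M) s \<le> weight_on (ground M) x"
proof -
  interpret increasing_weights "nullity M (ground M)" "ghw M" by (rule increasing_weights_ghw)
  define N where "N = weight_on (ground M) x"
  define U where "U t = ground M \<inter> {e. t \<le> Poly_Mapping.lookup x e}" for t
  have N: "Poly_Mapping.lookup x e \<le> N" if "e \<in> ground M" for e
    unfolding N_def weight_on_def using that finite_ground by (intro member_le_sum) auto
  \<comment> \<open>Level sets shrink as \<open>t\<close> grows, so they are indexed by
    \<open>N - t\<close> to form an increasing chain.\<close>
  have "\<exists>B\<in>bases (dual M). \<forall>t\<le>N. card (B \<inter> U (N - t)) = nullity M (U (N - t))"
    by (rule base_dual_meets_chain) (auto simp: U_def)
  then obtain B where B: "B \<in> bases (dual M)"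
      and BV: "\<And>t. t \<le> N \<Longrightarrow> card (B \<inter> U (N - t)) = nullity M (U (N - t))" by blast
  have BU: "card (B \<inter> U t) = nullity M (U t)" if "t \<le> N" for t
    using BV[of "N - t"] that by simp
  have B_sub: "B \<subseteq> ground M" using B by (auto simp: bases_dual)
  let ?as = "map (\<lambda>t. nullity M (U t)) [1..<Suc N]"
  have sum: "(\<Sum>t\<leftarrow>[1..<Suc N]. f t) = (\<Sum>t=1..N. f t)" for f :: "nat \<Rightarrow> nat"
    by (simp add: interv_sum_list_conv_sum_set_nat atLeastLessThanSuc_atLeastAtMost del: upt_Suc)
  have "weight_on B x = (\<Sum>t=1..N. card (B \<inter> {e. t \<le> Poly_Mapping.lookup x e}))"
    using B_sub finite_ground N by (intro weight_on_level_sets) (auto intro: finite_subset)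
  also have "\<dots> = (\<Sum>t=1..N. card (B \<inter> U t))"
    using B_sub by (intro sum.cong arg_cong[of _ _ card]) (auto simp: U_def)
  also have "\<dots> = (\<Sum>t=1..N. nullity M (U t))"
    by (intro sum.cong) (auto simp: BU)
  finally have "s \<le> sum_list ?as" using assms(2)[OF B] sum by simp
  \<comment> \<open>Level sets may have nullity 0, and their nullities may sum to more than
    \<open>s\<close>; \<open>exact_decomposition\<close> repairs both.\<close>
  moreover have "set ?as \<subseteq> {..nullity M (ground M)}"
    using nullity_mono[OF subset_refl] by (auto simp: U_def)
  ultimately obtain bs where bs: "set bs \<subseteq> {1..nullity M (ground M)}" "sum_list bs = s"
      "(\<Sum>b\<leftarrow>bs. ghw M b) \<le> (\<Sum>a\<leftarrow>?as. ghw M a)"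
    using exact_decomposition by blast
  have "(\<Sum>a\<leftarrow>?as. ghw M a) = (\<Sum>t=1..N. ghw M (nullity M (U t)))"
    using sum[of "\<lambda>t. ghw M (nullity M (U t))"] by (simp add: comp_def del: upt_Suc)
  also have "\<dots> \<le> (\<Sum>t=1..N. card (U t))"
    by (intro sum_mono ghw_le_card) (auto simp: U_def)
  also have "\<dots> = weight_on (ground M) x"
    unfolding U_def using finite_ground N by (intro weight_on_level_sets[symmetric])
  finally show ?thesis using min_cost_le[OF bs(1), of "ghw M"] bs(2,3) by simp
qed

lemma bases_dual_nonempty: "bases (dual M) \<noteq> {}"
  using indep_extend_base[OF indep_empty] by (auto simp: bases_dual)

text \<open>The monomial of an optimal decomposition attains the value. Conversely, every exponent
  of an element of the ideal has weight at least \<open>s\<close> on all bases of the dual, so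
  \<open>min_cost_le_weight_on\<close> bounds its degree.\<close>

lemma alpha_symbolic_power:
  assumes "nullity M (ground M) \<ge> 1"
  shows "alpha (symbolic_power (mpoly_ring (ground M) :: ('e, 'l::field) mpoly ring) M s) =
    min_cost (nullity M (ground M)) (ghw M) s"
proof -
  let ?I = "symbolic_power (mpoly_ring (ground M) :: ('e, 'l) mpoly ring) M s"
  have sub: "B \<subseteq> ground M" if "B \<in> bases (dual M)" for B
    using that by (auto simp: bases_dual)
  obtain as where as: "set as \<subseteq> {1..nullity M (ground M)}" "sum_list as = s"
      "(\<Sum>a\<leftarrow>as. ghw M a) = min_cost (nullity M (ground M)) (ghw M) s"
    using min_cost_attained[OF assms] by blast
  obtain x where x: "Poly_Mapping.keys x \<subseteq> ground M"
      "weight_on (ground M) x = (\<Sum>a\<leftarrow>as. ghw M a)"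
      "\<And>B. B \<in> bases (dual M) \<Longrightarrow> s \<le> weight_on B x"
    using exponent_of_decomposition[OF as(1)] as(2) by blast
  show ?thesis
  proof (rule alpha_eqI)
    show "monom x \<in> ?I"
      unfolding symbolic_power_def
      using monom_in_ideal_power[OF sub finite_ground x(1) x(3)] by blast
    show "monom x \<noteq> (0 :: ('e, 'l) mpoly)"
      by (metis keys_eq_empty keys_single insert_not_empty zero_neq_one)
    show "homogeneous (min_cost (nullity M (ground M)) (ghw M) s) (monom x :: ('e, 'l) mpoly)"
      using homogeneous_monom[of x] monomial_deg_eq_weight_on[OF finite_ground x(1)] x(2) as(3)
      by simp
  next
    fix q :: "('e, 'l) mpoly" and y
    assume q: "q \<in> ?I" and y: "y \<in> Poly_Mapping.keys q"
    have wt: "Poly_Mapping.keys y \<subseteq> ground M \<and> s \<le> weight_on B y" if B: "B \<in> bases (dual M)" for B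
      by (rule weight_on_ideal_power[OF sub[OF B] finite_ground _ y])
        (use q B in \<open>auto simp: symbolic_power_def\<close>)
    then have keys: "Poly_Mapping.keys y \<subseteq> ground M" using bases_dual_nonempty by blast
    then show "min_cost (nullity M (ground M)) (ghw M) s \<le> monomial_deg y"
      using min_cost_le_weight_on[OF keys] wt monomial_deg_eq_weight_on[OF finite_ground keys]
      by auto
  qed
qed

text \<open>The circuits of the elongation are the minimal sets of nullity at least
  \<open>i\<close>. A smallest set of nullity \<open>i\<close> is one of them, and the support of
  every monomial in the ideal contains one, which has at least \<open>ghw M i\<close>
  elements.\<close>

lemma alpha_SR_ideal_elongation:
  assumes "i \<in> {1..nullity M (ground M)}"
  shows "alpha (SR_ideal (mpoly_ring (ground M) :: ('e, 'l::field) mpoly ring) (elongation M i)) =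
    ghw M i"
proof -
  let ?S = "mpoly_ring (ground M) :: ('e, 'l) mpoly ring"
  let ?C = "circuits (elongation M i)"
  interpret ring ?S by (rule ring_mpoly_ring)
  \<comment> \<open>As \<open>i \<ge> 1\<close>, the bound \<open>\<le> i - 1\<close> in the
    elongation means \<open>< i\<close>.\<close>
  have indep: "indep (elongation M i) A \<longleftrightarrow> A \<subseteq> ground M \<and> nullity M A < i" for A
    using assms by (auto simp: elongation_def nullity_def)
  have circuits: "C \<in> ?C \<longleftrightarrow> C \<subseteq> ground M \<and> i \<le> nullity M C \<and> (\<forall>A. A \<subset> C \<longrightarrow> nullity M A < i)"
    for C
    unfolding circuits_def mem_Collect_eq indep by (auto simp: elongation_def)
  have finite_circuit: "finite C" if "C \<in> ?C" for C
    using that circuits[of C] finite_subset_ground[of C] by simp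
  obtain U where U: "U \<subseteq> ground M" "nullity M U = i" "card U = ghw M i"
    using ghw_attained[of i] assms by auto
  have fU: "finite U" using U(1) finite_subset_ground by blast
  have "nullity M A < i" if A: "A \<subset> U" for A
  proof (rule ccontr)
    assume "\<not> nullity M A < i"
    then have "ghw M i \<le> card A"
      using A U(1) by (intro le_nullity_imp_ghw_le_card) auto
    then show False using psubset_card_mono[OF fU A] U(3) by simp
  qed
  then have "U \<in> ?C" using U circuits[of U] by simp
  then have "(\<Prod>e\<in>U. mvar e) \<in> {\<Prod>e\<in>C. mvar e | C. C \<in> ?C}" by blast
  moreover have gens: "{\<Prod>e\<in>C. mvar e | C. C \<in> ?C} \<subseteq> carrier ?S"
  proof
    fix p :: "('e, 'l) mpoly" assume "p \<in> {\<Prod>e\<in>C. mvar e | C. C \<in> ?C}"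
    then obtain C where C: "C \<in> ?C" "p = (\<Prod>e\<in>C. mvar e)" by blast
    then show "p \<in> carrier ?S"
      using circuits[of C] by (simp add: prod_mvar keys_indicator_exponent finite_circuit)
  qed
  ultimately have mem: "monom (indicator_exponent U) \<in> SR_ideal ?S (elongation M i)"
    unfolding SR_ideal_def prod_mvar[OF fU, symmetric] using genideal_self by blast
  show ?thesis
  proof (rule alpha_eqI[OF mem])
    show "monom (indicator_exponent U) \<noteq> (0 :: ('e, 'l) mpoly)"
      by (metis keys_eq_empty keys_single insert_not_empty zero_neq_one)
    show "homogeneous (ghw M i) (monom (indicator_exponent U) :: ('e, 'l) mpoly)"
      using homogeneous_monom[of "indicator_exponent U"] monomial_deg_indicator_exponent[OF fU] U(3)
      by simp
  next
    fix q :: "('e, 'l) mpoly" and x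
    assume q: "q \<in> SR_ideal ?S (elongation M i)" and x: "x \<in> Poly_Mapping.keys q"
    have "\<exists>C\<in>?C. C \<subseteq> Poly_Mapping.keys x"
    proof (rule genideal_subset_monomial_condition[OF _ _ q[unfolded SR_ideal_def] x])
      fix y z :: "'e \<Rightarrow>\<^sub>0 nat" assume "\<exists>C\<in>?C. C \<subseteq> Poly_Mapping.keys y"
      moreover have "Poly_Mapping.keys y \<subseteq> Poly_Mapping.keys (y + z)"
        by (auto simp: in_keys_iff lookup_add)
      ultimately show "\<exists>C\<in>?C. C \<subseteq> Poly_Mapping.keys (y + z)" by blast
    next
      fix p :: "('e, 'l) mpoly" and y
      assume "p \<in> {\<Prod>e\<in>C. mvar e | C. C \<in> ?C}" and y: "y \<in> Poly_Mapping.keys p"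
      then obtain C where C: "C \<in> ?C" "p = (\<Prod>e\<in>C. mvar e)" by blast
      then have "y = indicator_exponent C" using y by (simp add: prod_mvar finite_circuit)
      then have "Poly_Mapping.keys y = C" using C by (simp add: keys_indicator_exponent finite_circuit)
      then show "Poly_Mapping.keys y \<subseteq> ground M \<and> (\<exists>C\<in>?C. C \<subseteq> Poly_Mapping.keys y)"
        using C(1) circuits[of C] by blast
    qed
    then obtain C where C: "C \<in> ?C" "C \<subseteq> Poly_Mapping.keys x" by blast
    have "ghw M i \<le> card C" using C(1) circuits[of C] by (intro le_nullity_imp_ghw_le_card) auto
    then show "ghw M i \<le> monomial_deg x" using card_le_monomial_deg[OF C(2)] by simp
  qed
qed

lemma waldschmidt_seq_tendsto:
  assumes "nullity M (ground M) \<ge> 1"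
  shows "waldschmidt_seq (mpoly_ring (ground M) :: ('e, 'l::field) mpoly ring) M \<longlonglongrightarrow>
    (MIN i\<in>{1..nullity M (ground M)}. real (ghw M i) / real i)"
  unfolding waldschmidt_seq_def alpha_symbolic_power[OF assms]
  by (rule min_cost_ratio_tendsto[OF assms])

section \<open>Wei duality\<close>

lemma nullity_le_count_upto:
  assumes "U \<subseteq> ground M"
  shows "nullity M U \<le> count_upto (nullity M (ground M)) (ghw M) (card U)"
proof -
  interpret increasing_weights "nullity M (ground M)" "ghw M" by (rule increasing_weights_ghw)
  show ?thesis
    using weight_le_iff[OF nullity_mono[OF subset_refl assms]] ghw_le_card[OF assms] by blast
qed

text \<open>A smallest set of nullity \<open>?c\<close> has at most \<open>x\<close> elements and
  can be enlarged to size \<open>x\<close>; \<open>nullity_le_count_upto\<close> keeps its nullity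
  from growing.\<close>

lemma count_upto_attained:
  assumes "x \<le> card (ground M)"
  shows "\<exists>U\<subseteq>ground M. card U = x \<and> nullity M U = count_upto (nullity M (ground M)) (ghw M) x"
proof -
  let ?c = "count_upto (nullity M (ground M)) (ghw M) x"
  interpret increasing_weights "nullity M (ground M)" "ghw M" by (rule increasing_weights_ghw)
  obtain V where V: "V \<subseteq> ground M" "nullity M V = ?c" "card V = ghw M ?c"
    using ghw_attained[OF count_upto_le] by blast
  have "card V \<le> x" using V(3) weight_count_upto by simp
  then obtain U where U: "V \<subseteq> U" "U \<subseteq> ground M" "card U = x"
    using exists_subset_between[OF _ assms V(1) finite_ground] by blast
  have "nullity M U = ?c"
    using nullity_mono[OF U(2,1)] nullity_le_count_upto[OF U(2)] V(2) U(3) by simp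
  then show ?thesis using U by blast
qed

lemma nullity_dual:
  assumes "U \<subseteq> ground M"
  shows "nullity (dual M) U + nullity M (ground M) = card U + nullity M (ground M - U)"
proof -
  interpret D: matroid "dual M" by (rule matroid_dual)
  have "card (ground M) = card U + card (ground M - U)"
    using assms finite_ground by (metis card_Diff_subset card_mono finite_subset le_add_diff_inverse)
  then show ?thesis
    using rk_dual[OF assms] rk_plus_nullity[of "ground M"] rk_plus_nullity[of "ground M - U"]
      D.rk_plus_nullity[of U] assms by auto
qed

lemma wei_dual_weights_ghw:
  "wei_dual_weights (nullity M (ground M)) (nullity (dual M) (ground M))
    (ghw M) (ghw (dual M)) (card (ground M))"
proof -
  interpret D: matroid "dual M" by (rule matroid_dual)
  show ?thesis
  proof (intro wei_dual_weights.intro wei_dual_weights_axioms.intro)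
    show "increasing_weights (nullity M (ground M)) (ghw M)" by (rule increasing_weights_ghw)
    show "increasing_weights (nullity (dual M) (ground M)) (ghw (dual M))"
      using D.increasing_weights_ghw by simp
    show "nullity M (ground M) + nullity (dual M) (ground M) = card (ground M)"
      using nullity_dual[of "ground M"] by simp
    show "ghw M j \<le> card (ground M)" if "j \<le> nullity M (ground M)" for j
      using that by (rule ghw_le_card_ground)
    show "ghw (dual M) j \<le> card (ground M)" if "j \<le> nullity (dual M) (ground M)" for j
      using that D.ghw_le_card_ground by simp
  next
    fix x assume x: "x \<le> card (ground M)"
    have card_compl: "card (ground M - V) = card (ground M) - card V" if "V \<subseteq> ground M" for V
      using that finite_ground by (metis card_Diff_subset finite_subset)
    \<comment> \<open>Two inequalities give the identity: \<open>U\<close> is optimal for the dual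
      at size \<open>x\<close> and its complement bounds the count of \<open>M\<close> from below;
      \<open>V\<close>, optimal for \<open>M\<close> at the complementary size, does the same for
      the dual count.\<close>
    obtain U where U: "U \<subseteq> ground M" "card U = x"
        "nullity (dual M) U = count_upto (nullity (dual M) (ground M)) (ghw (dual M)) x"
      using D.count_upto_attained[of x] x by auto
    have "nullity M (ground M - U) \<le>
        count_upto (nullity M (ground M)) (ghw M) (card (ground M) - x)"
      using nullity_le_count_upto[of "ground M - U"] card_compl[OF U(1)] U(2) by auto
    then have "count_upto (nullity (dual M) (ground M)) (ghw (dual M)) x + nullity M (ground M) \<le>
        x + count_upto (nullity M (ground M)) (ghw M) (card (ground M) - x)"
      using nullity_dual[OF U(1)] U by simp
    moreover obtain V where V: "V \<subseteq> ground M" "card V = card (ground M) - x"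
        "nullity M V = count_upto (nullity M (ground M)) (ghw M) (card (ground M) - x)"
      using count_upto_attained[of "card (ground M) - x"] by auto
    have "card (ground M - V) = x" using card_compl[OF V(1)] V(2) x by simp
    moreover from this have "nullity (dual M) (ground M - V) \<le>
        count_upto (nullity (dual M) (ground M)) (ghw (dual M)) x"
      using D.nullity_le_count_upto[of "ground M - V"] by auto
    moreover have "ground M - (ground M - V) = V" using V(1) by blast
    ultimately show "count_upto (nullity (dual M) (ground M)) (ghw (dual M)) x + nullity M (ground M) =
        x + count_upto (nullity M (ground M)) (ghw M) (card (ground M) - x)"
      using nullity_dual[of "ground M - V"] V(3) by auto
  qed
qed

text \<open>\<open>ghw_fmax_dual\<close> turns each numerator into a weight, and
  \<open>i = nullity M (ground M) - j\<close> matches the index ranges.\<close>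

lemma min_ratio_fmax_dual:
  assumes "nullity M (ground M) \<ge> 1"
  shows "(MIN i\<in>{1..nullity M (ground M)}. real (ghw M i) / real i) =
    (MIN j\<in>{0..nullity M (ground M) - 1}.
      (real (card (ground M)) - real (fmax (dual M) j)) / real (nullity M (ground M) - j))"
proof -
  let ?\<nu> = "nullity M (ground M)"
  have "(\<lambda>j. (real (card (ground M)) - real (fmax (dual M) j)) / real (?\<nu> - j)) ` {0..?\<nu> - 1} =
      (\<lambda>j. real (ghw M (?\<nu> - j)) / real (?\<nu> - j)) ` {0..?\<nu> - 1}"
  proof (rule image_cong[OF refl])
    fix j assume "j \<in> {0..?\<nu> - 1}"
    then have "real (card (ground M)) = real (ghw M (?\<nu> - j)) + real (fmax (dual M) j)"
      using ghw_fmax_dual[of j] by (metis assms atLeastAtMost_iff diff_le_self le_trans of_nat_add)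
    then show "(real (card (ground M)) - real (fmax (dual M) j)) / real (?\<nu> - j) =
        real (ghw M (?\<nu> - j)) / real (?\<nu> - j)" by simp
  qed
  also have "\<dots> = (\<lambda>i. real (ghw M i) / real i) ` (\<lambda>j. ?\<nu> - j) ` {0..?\<nu> - 1}"
    by (simp add: image_image)
  also have "(\<lambda>j. ?\<nu> - j) ` {0..?\<nu> - 1} = {1..?\<nu>}"
  proof (intro subset_antisym subsetI)
    fix i assume "i \<in> {1..?\<nu>}"
    then show "i \<in> (\<lambda>j. ?\<nu> - j) ` {0..?\<nu> - 1}"
      by (intro image_eqI[of _ _ "?\<nu> - i"]) auto
  qed (use assms in auto)
  finally show ?thesis by simp
qed

end

theorem theorem5p9:
  fixes M :: "'e matroid_data"
    and S :: "('e, 'l::field) mpoly ring"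
    and n k :: nat
  assumes "matroid M"
    and "card (ground M) = n"
    and "rk M (ground M) = k"
    and "0 < k" and "k < n"
    and "S = mpoly_ring (ground M)"
  shows "(\<forall>i\<in>{1..n - k}.
      ghw M i = alpha (SR_ideal S (elongation M i)) \<and>
      alpha (SR_ideal S (elongation M i)) \<ge> alpha (symbolic_power S M i)) \<and>
    (\<forall>i\<in>{1..n - k}.
      alpha (symbolic_power S M i) = ghw M i \<longleftrightarrow> subadditive_term (n - k) (ghw M) i) \<and>
    (convergent (waldschmidt_seq S M) \<and>
      waldschmidt S M = (MIN i\<in>{1..n - k}. real (ghw M i) / real i) \<and>
      (MIN i\<in>{1..n - k}. real (ghw M i) / real i) =
        (MIN j\<in>{0..n - k - 1}. (real n - real (fmax (dual M) j)) / (real n - real k - real j))) \<and>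
    (\<forall>s\<ge>1.
      alpha (symbolic_power S M s) =
        Min {\<Sum>i=1..n - k. b i * ghw M i | b :: nat \<Rightarrow> nat. (\<Sum>i=1..n - k. i * b i) = s} \<and>
      Min {\<Sum>i=1..n - k. b i * ghw M i | b :: nat \<Rightarrow> nat. (\<Sum>i=1..n - k. i * b i) = s} =
        Min {\<Sum>i=1..n - k. b i * ghw M i | b :: nat \<Rightarrow> nat. (\<Sum>i=1..n - k. i * b i) = s \<and>
          (\<forall>i\<in>{1..n - k}. b i > 0 \<longrightarrow> strictly_subadditive_term (n - k) (ghw M) i)}) \<and>
    ((\<nexists>x. loop M x) \<and> (\<nexists>x. coloop M x) \<longrightarrow>
      ((subadditive (n - k) (ghw M) \<and> cosubadditive n (n - k) (ghw M)) \<longleftrightarrow>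
        (\<forall>q. \<forall>r\<in>{1..n - k}. alpha (symbolic_power S M ((n - k) * q + r)) =
          q * ghw M (n - k) + ghw M r)) \<and>
      ((\<forall>q. \<forall>r\<in>{1..n - k}. alpha (symbolic_power S M ((n - k) * q + r)) =
          q * ghw M (n - k) + ghw M r) \<longleftrightarrow>
        (\<forall>q. \<forall>r\<in>{1..k}. alpha (symbolic_power S (dual M) (k * q + r)) =
          q * ghw (dual M) k + ghw (dual M) r)) \<and>
      (subadditive (n - k) (ghw M) \<and> cosubadditive n (n - k) (ghw M) \<longrightarrow>
        convergent (waldschmidt_seq S M) \<and> convergent (waldschmidt_seq S (dual M)) \<and>
        waldschmidt S M = real (ghw M (n - k)) / real (n - k) \<and>
        real (ghw M (n - k)) / real (n - k) = real n / real (n - k) \<and>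
        waldschmidt S (dual M) = real (ghw (dual M) k) / real k \<and>
        real (ghw (dual M) k) / real k = real n / real k \<and>
        1 / waldschmidt S M + 1 / waldschmidt S (dual M) = 1))"
proof -
  interpret matroid M by (rule assms(1))
  interpret D: matroid "dual M" by (rule matroid_dual)
  define m where "m = n - k"
  let ?d = "ghw M" and ?d' = "ghw (dual M)"
  have nul: "nullity M (ground M) = m" "nullity (dual M) (ground M) = k"
    using assms(2,3) nullity_ground_dual by (simp_all add: nullity_def m_def)
  have m: "m \<ge> 1" and k: "k \<ge> 1" using assms(4,5) by (simp_all add: m_def)
  interpret W: wei_dual_weights m k ?d ?d' n
    using wei_dual_weights_ghw nul assms(2) by simp
  \<comment> \<open>The roles are exchanged, the bidual being \<open>M\<close> itself, to obtain the
    wrap condition of the dual sequence as well.\<close>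
  interpret W': wei_dual_weights k m ?d' ?d n
    using D.wei_dual_weights_ghw nul assms(2) by (simp add: dual_dual)
  have alpha: "alpha (symbolic_power S M s) = min_cost m ?d s" for s
    using alpha_symbolic_power[where 'l = 'l] m nul assms(6) by simp
  have alpha': "alpha (symbolic_power S (dual M) s) = min_cost k ?d' s" for s
    using D.alpha_symbolic_power[where 'l = 'l] k nul assms(6) by simp
  have SR: "alpha (SR_ideal S (elongation M i)) = ?d i" if "i \<in> {1..m}" for i
    using alpha_SR_ideal_elongation[where 'l = 'l] that nul assms(6) by simp
  have lim: "waldschmidt_seq S M \<longlonglongrightarrow> (MIN i\<in>{1..m}. real (?d i) / real i)"
    using waldschmidt_seq_tendsto[where 'l = 'l] m nul assms(6) by simp
  have lim': "waldschmidt_seq S (dual M) \<longlonglongrightarrow> (MIN i\<in>{1..k}. real (?d' i) / real i)"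
    using D.waldschmidt_seq_tendsto[where 'l = 'l] k nul assms(6) by simp
  have wald: "waldschmidt S M = (MIN i\<in>{1..m}. real (?d i) / real i)"
    "waldschmidt S (dual M) = (MIN i\<in>{1..k}. real (?d' i) / real i)"
    unfolding waldschmidt_def using lim lim' by (simp_all add: limI)

  have a: "\<forall>i\<in>{1..m}. ?d i = alpha (SR_ideal S (elongation M i)) \<and>
      alpha (SR_ideal S (elongation M i)) \<ge> alpha (symbolic_power S M i)"
    using SR alpha min_cost_le[of "[i]" m ?d for i] by auto
  have b: "\<forall>i\<in>{1..m}. alpha (symbolic_power S M i) = ?d i \<longleftrightarrow> subadditive_term m ?d i"
    unfolding alpha using min_cost_eq_iff_subadditive_term by blast
  have "(MIN i\<in>{1..m}. real (?d i) / real i) =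
      (MIN j\<in>{0..m - 1}. (real n - real (fmax (dual M) j)) / real (m - j))"
    using min_ratio_fmax_dual m nul assms(2) by simp
  \<comment> \<open>For \<open>j \<le> m - 1\<close> the natural differences do not truncate and
    agree with the real ones.\<close>
  also have "\<dots> = (MIN j\<in>{0..m - 1}. (real n - real (fmax (dual M) j)) / (real n - real k - real j))"
    using m assms(5) by (intro arg_cong[of _ _ Min] image_cong) (auto simp: m_def of_nat_diff)
  finally have c: "convergent (waldschmidt_seq S M) \<and>
      waldschmidt S M = (MIN i\<in>{1..m}. real (?d i) / real i) \<and>
      (MIN i\<in>{1..m}. real (?d i) / real i) =
        (MIN j\<in>{0..m - 1}. (real n - real (fmax (dual M) j)) / (real n - real k - real j))"
    using lim wald(1) convergentI by blast
  have "{i. Suc 0 \<le> i \<and> i \<le> m} = {Suc 0..m}" by auto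
  then have "{\<Sum>i=1..m. b i * ?d i | b :: nat \<Rightarrow> nat. (\<Sum>i=1..m. i * b i) = s} =
      costs {1..m} ?d s" for s
    using multiplicity_costs[where m = m and d = ?d and s = s and P = "\<lambda>_. True"] by simp
  then have d: "\<forall>s\<ge>1.
      alpha (symbolic_power S M s) =
        Min {\<Sum>i=1..m. b i * ?d i | b :: nat \<Rightarrow> nat. (\<Sum>i=1..m. i * b i) = s} \<and>
      Min {\<Sum>i=1..m. b i * ?d i | b :: nat \<Rightarrow> nat. (\<Sum>i=1..m. i * b i) = s} =
        Min {\<Sum>i=1..m. b i * ?d i | b :: nat \<Rightarrow> nat. (\<Sum>i=1..m. i * b i) = s \<and>
          (\<forall>i\<in>{1..m}. b i > 0 \<longrightarrow> strictly_subadditive_term m ?d i)}"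
    unfolding multiplicity_costs using alpha min_cost_strictly_subadditive_terms[OF m] by simp

  have e: "((subadditive m ?d \<and> cosubadditive n m ?d) \<longleftrightarrow>
        (\<forall>q. \<forall>r\<in>{1..m}. alpha (symbolic_power S M (m * q + r)) = q * ?d m + ?d r)) \<and>
      ((\<forall>q. \<forall>r\<in>{1..m}. alpha (symbolic_power S M (m * q + r)) = q * ?d m + ?d r) \<longleftrightarrow>
        (\<forall>q. \<forall>r\<in>{1..k}. alpha (symbolic_power S (dual M) (k * q + r)) = q * ?d' k + ?d' r)) \<and>
      (subadditive m ?d \<and> cosubadditive n m ?d \<longrightarrow>
        convergent (waldschmidt_seq S M) \<and> convergent (waldschmidt_seq S (dual M)) \<and>
        waldschmidt S M = real (?d m) / real m \<and>
        real (?d m) / real m = real n / real m \<and>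
        waldschmidt S (dual M) = real (?d' k) / real k \<and>
        real (?d' k) / real k = real n / real k \<and>
        1 / waldschmidt S M + 1 / waldschmidt S (dual M) = 1)"
    if loops: "(\<nexists>x. loop M x) \<and> (\<nexists>x. coloop M x)"
  proof -
    \<comment> \<open>The first equation holds because \<open>M\<close> has no coloops, the second
      because a coloop of the dual would be a loop of \<open>M\<close>.\<close>
    have top: "?d m = n" "?d' k = n"
      using loops ghw_nullity_ground D.ghw_nullity_ground coloop_dual nul assms(2) by auto
    \<comment> \<open>The wrap condition of either sequence is subadditivity of the other, so
      periodicity on either side means that both sequences are subadditive, a condition symmetric
      under duality.\<close>
    note wrap = W.subadditive_dual_iff_wrap[OF top] W'.subadditive_dual_iff_wrap[OF top(2,1)]
    note cosub = W.cosubadditive_iff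
    have B: "(\<forall>q. \<forall>r\<in>{1..m}. alpha (symbolic_power S M (m * q + r)) = q * ?d m + ?d r) \<longleftrightarrow>
        subadditive m ?d \<and> subadditive k ?d'"
      unfolding alpha W.W.periodic_min_cost_iff[OF m] wrap(1) ..
    have C: "(\<forall>q. \<forall>r\<in>{1..k}. alpha (symbolic_power S (dual M) (k * q + r)) = q * ?d' k + ?d' r) \<longleftrightarrow>
        subadditive m ?d \<and> subadditive k ?d'"
      unfolding alpha' W.W'.periodic_min_cost_iff[OF k] wrap(2) by blast
    have "waldschmidt S M = real (?d m) / real m \<and>
        waldschmidt S (dual M) = real (?d' k) / real k \<and>
        1 / waldschmidt S M + 1 / waldschmidt S (dual M) = 1"
      if "subadditive m ?d" "subadditive k ?d'"
    proof -
      have "waldschmidt S M = real (?d m) / real m" "waldschmidt S (dual M) = real (?d' k) / real k"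
        using W.W.periodic_min_ratio[OF m] W.W'.periodic_min_ratio[OF k] that wrap wald by auto
      \<comment> \<open>With top weights \<open>n\<close>, these summands are the reciprocals of the
        two Waldschmidt constants.\<close>
      moreover have "real m / real n + real k / real n = 1"
        using assms(4,5) by (simp add: m_def of_nat_diff flip: add_divide_distrib)
      ultimately show ?thesis using top by simp
    qed
    then show ?thesis
      unfolding B C cosub using top lim lim' convergentI by auto
  qed
  show ?thesis
    using a b c d e unfolding m_def by blast
qed

end
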